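(* Let $K$ be a countable field of characteristic $0$ and $S$ the group of finitely supported permutations of $\mathbb{N}$. Then the two-sided ideals of the group algebra $K[S]$ satisfy the antichain condition: there is no infinite sequence of two-sided ideals of $K[S]$ which are pairwise incomparable under inclusion.
   Context: $\mathbb{N}$ denotes the positive integers. The group algebra $K[S]$ consists of formal finite $K$-linear combinations of elements of $S$ with the usual operations. A two-sided ideal is a nonempty subset closed under addition and under multiplication on either side by elements of $K[S]$. *)

theory Defs
  imports "HOL-Library.Countable_Set" "HOL-Algebra.Ideal" "HOL-Algebra.Sym_Groups"
begin

text \<open>
  As in \<^const>\<open>sym_group\<close>, a permutation of \<open>A\<close> is a function on the whole type that is
  the identity outside \<open>A\<close>.
\<close>

definition finitary_sym_group :: "'a set \<Rightarrow> ('a \<Rightarrow> 'a) monoid" where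
  "finitary_sym_group A =
     \<lparr> carrier = {p. p permutes A \<and> finite {x. p x \<noteq> x}}, monoid.mult = (\<circ>), one = id \<rparr>"

lemma group_finitary_sym_group: "group (finitary_sym_group A)"
proof (rule groupI)
  fix p q
  assume p: "p \<in> carrier (finitary_sym_group A)" and q: "q \<in> carrier (finitary_sym_group A)"
  have "{x. (p \<circ> q) x \<noteq> x} \<subseteq> {x. p x \<noteq> x} \<union> {x. q x \<noteq> x}"
    by auto
  then have "finite {x. (p \<circ> q) x \<noteq> x}"
    using p q by (auto simp: finitary_sym_group_def intro: finite_subset)
  then show "p \<otimes>\<^bsub>finitary_sym_group A\<^esub> q \<in> carrier (finitary_sym_group A)"
    using p q by (simp add: finitary_sym_group_def permutes_compose)
next
  show "\<one>\<^bsub>finitary_sym_group A\<^esub> \<in> carrier (finitary_sym_group A)"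
    by (simp add: finitary_sym_group_def permutes_id)
next
  fix p
  assume p: "p \<in> carrier (finitary_sym_group A)"
  then have perm: "p permutes A" by (simp add: finitary_sym_group_def)
  have "{x. inv' p x \<noteq> x} = {x. p x \<noteq> x}"
    using permutes_inv_eq[OF perm] by metis
  then have "inv' p \<in> carrier (finitary_sym_group A)"
    using p by (simp add: finitary_sym_group_def permutes_inv)
  moreover have "inv' p \<otimes>\<^bsub>finitary_sym_group A\<^esub> p = \<one>\<^bsub>finitary_sym_group A\<^esub>"
    using permutes_inv_o(2)[OF perm] by (simp add: finitary_sym_group_def)
  ultimately show "\<exists>q\<in>carrier (finitary_sym_group A).
      q \<otimes>\<^bsub>finitary_sym_group A\<^esub> p = \<one>\<^bsub>finitary_sym_group A\<^esub>"
    by blast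
qed (simp_all add: finitary_sym_group_def comp_assoc)

text \<open>
  A formal finite linear combination of elements of \<open>G\<close> is represented by its coefficient
  function, which vanishes outside the carrier of \<open>G\<close>. The product is the bilinear extension
  of the product of \<open>G\<close>.
\<close>

definition group_algebra :: "('g, 'm) monoid_scheme \<Rightarrow> ('g \<Rightarrow> 'k::field) ring" where
  "group_algebra G =
     \<lparr> carrier = {f. finite {x. f x \<noteq> 0} \<and> {x. f x \<noteq> 0} \<subseteq> carrier G},
       monoid.mult = (\<lambda>f h g. \<Sum>(x, y) | f x \<noteq> 0 \<and> h y \<noteq> 0 \<and> x \<otimes>\<^bsub>G\<^esub> y = g. f x * h y),
       one = (\<lambda>g. if g = \<one>\<^bsub>G\<^esub> then 1 else 0),
       zero = (\<lambda>g. 0),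
       add = (\<lambda>f h g. f g + h g) \<rparr>"

lemma group_algebra_mult_eq:
  fixes f h :: "'g \<Rightarrow> 'k::field"
  assumes "finite A" "{x. f x \<noteq> 0} \<subseteq> A" "finite B" "{x. h x \<noteq> 0} \<subseteq> B"
  shows "(f \<otimes>\<^bsub>group_algebra G\<^esub> h) g =
    (\<Sum>x\<in>A. \<Sum>y\<in>B. if x \<otimes>\<^bsub>G\<^esub> y = g then f x * h y else 0)"
proof -
  have "(f \<otimes>\<^bsub>group_algebra G\<^esub> h) g =
      (\<Sum>(x, y)\<in>A \<times> B. if x \<otimes>\<^bsub>G\<^esub> y = g then f x * h y else 0)"
    using assms by (auto simp: group_algebra_def intro!: sum.mono_neutral_cong_left split: if_splits)
  then show ?thesis
    by (simp add: sum.cartesian_product)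
qed

lemma group_algebra_mult_supp:
  fixes f h :: "'g \<Rightarrow> 'k::field"
  assumes "finite A" "{x. f x \<noteq> 0} \<subseteq> A" "finite B" "{x. h x \<noteq> 0} \<subseteq> B"
  shows "{g. (f \<otimes>\<^bsub>group_algebra G\<^esub> h) g \<noteq> 0} \<subseteq> (\<lambda>(x, y). x \<otimes>\<^bsub>G\<^esub> y) ` (A \<times> B)"
proof
  fix g
  assume "g \<in> {g. (f \<otimes>\<^bsub>group_algebra G\<^esub> h) g \<noteq> 0}"
  then have "(\<Sum>x\<in>A. \<Sum>y\<in>B. if x \<otimes>\<^bsub>G\<^esub> y = g then f x * h y else 0) \<noteq> 0"
    by (simp add: group_algebra_mult_eq[OF assms])
  then obtain x y where "x \<in> A" "y \<in> B" "x \<otimes>\<^bsub>G\<^esub> y = g"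
    by (elim sum.not_neutral_contains_not_neutral) (metis (full_types))
  then show "g \<in> (\<lambda>(x, y). x \<otimes>\<^bsub>G\<^esub> y) ` (A \<times> B)"
    by force
qed

lemma group_algebra_mult_sum:
  fixes f h \<phi> :: "'g \<Rightarrow> 'k::field"
  assumes "finite A" "{x. f x \<noteq> 0} \<subseteq> A" "finite B" "{x. h x \<noteq> 0} \<subseteq> B"
    and U: "U = (\<lambda>(x, y). x \<otimes>\<^bsub>G\<^esub> y) ` (A \<times> B)"
  shows "(\<Sum>u\<in>U. (f \<otimes>\<^bsub>group_algebra G\<^esub> h) u * \<phi> u) =
    (\<Sum>x\<in>A. \<Sum>y\<in>B. f x * h y * \<phi> (x \<otimes>\<^bsub>G\<^esub> y))"
proof -
  have finU: "finite U" using assms by simp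
  have "(\<Sum>u\<in>U. (f \<otimes>\<^bsub>group_algebra G\<^esub> h) u * \<phi> u) =
      (\<Sum>u\<in>U. \<Sum>x\<in>A. \<Sum>y\<in>B. if x \<otimes>\<^bsub>G\<^esub> y = u then f x * h y * \<phi> u else 0)"
    unfolding group_algebra_mult_eq[OF assms(1-4)] sum_distrib_right
    by (intro sum.cong refl) simp
  also have "\<dots> = (\<Sum>x\<in>A. \<Sum>u\<in>U. \<Sum>y\<in>B. if x \<otimes>\<^bsub>G\<^esub> y = u then f x * h y * \<phi> u else 0)"
    by (rule sum.swap)
  also have "\<dots> = (\<Sum>x\<in>A. \<Sum>y\<in>B. \<Sum>u\<in>U. if x \<otimes>\<^bsub>G\<^esub> y = u then f x * h y * \<phi> u else 0)"
    by (intro sum.cong refl sum.swap)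
  also have "\<dots> = (\<Sum>x\<in>A. \<Sum>y\<in>B. f x * h y * \<phi> (x \<otimes>\<^bsub>G\<^esub> y))"
  proof (intro sum.cong refl)
    fix x y assume "x \<in> A" "y \<in> B"
    then have "x \<otimes>\<^bsub>G\<^esub> y \<in> U" using U by force
    then show "(\<Sum>u\<in>U. if x \<otimes>\<^bsub>G\<^esub> y = u then f x * h y * \<phi> u else 0) = f x * h y * \<phi> (x \<otimes>\<^bsub>G\<^esub> y)"
      using finU by simp
  qed
  finally show ?thesis .
qed

lemma ring_group_algebra:
  assumes "group G"
  shows "ring (group_algebra G :: ('g \<Rightarrow> 'k::field) ring)"
proof -
  interpret G: group G by fact
  let ?R = "group_algebra G :: ('g \<Rightarrow> 'k) ring"
  let ?S = "\<lambda>f :: 'g \<Rightarrow> 'k. {x. f x \<noteq> 0}"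
  have carr: "f \<in> carrier ?R \<longleftrightarrow> finite (?S f) \<and> ?S f \<subseteq> carrier G" for f
    by (simp add: group_algebra_def)
  have add: "f \<oplus>\<^bsub>?R\<^esub> h = (\<lambda>g. f g + h g)" for f h
    by (simp add: group_algebra_def)
  have one: "\<one>\<^bsub>?R\<^esub> = (\<lambda>g. if g = \<one>\<^bsub>G\<^esub> then 1 else 0)"
    by (simp add: group_algebra_def)
  have zero: "\<zero>\<^bsub>?R\<^esub> = (\<lambda>g. 0)"
    by (simp add: group_algebra_def)
  have one_carr: "\<one>\<^bsub>?R\<^esub> \<in> carrier ?R"
    by (auto simp: carr one)
  have Sadd: "?S (f \<oplus>\<^bsub>?R\<^esub> h) \<subseteq> ?S f \<union> ?S h" for f h
    by (auto simp: add)
  have add_carr: "f \<oplus>\<^bsub>?R\<^esub> h \<in> carrier ?R" if "f \<in> carrier ?R" "h \<in> carrier ?R" for f h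
    using that Sadd[of f h] unfolding carr by (meson finite_UnI finite_subset le_sup_iff subset_trans)
  have mult_carr: "f \<otimes>\<^bsub>?R\<^esub> h \<in> carrier ?R" if "f \<in> carrier ?R" "h \<in> carrier ?R" for f h
  proof -
    have S: "?S (f \<otimes>\<^bsub>?R\<^esub> h) \<subseteq> (\<lambda>(x, y). x \<otimes>\<^bsub>G\<^esub> y) ` (?S f \<times> ?S h)"
      using that by (intro group_algebra_mult_supp) (auto simp: carr)
    moreover have "finite ((\<lambda>(x, y). x \<otimes>\<^bsub>G\<^esub> y) ` (?S f \<times> ?S h))"
      using that by (auto simp: carr)
    moreover have "(\<lambda>(x, y). x \<otimes>\<^bsub>G\<^esub> y) ` (?S f \<times> ?S h) \<subseteq> carrier G"
      using that by (force simp: carr)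
    ultimately show ?thesis
      unfolding carr by (meson finite_subset subset_trans)
  qed
  show ?thesis
  proof (rule ringI)
    show "abelian_group ?R"
    proof (rule abelian_groupI)
      fix f assume "f \<in> carrier ?R"
      then show "\<exists>h\<in>carrier ?R. h \<oplus>\<^bsub>?R\<^esub> f = \<zero>\<^bsub>?R\<^esub>"
        by (intro bexI[of _ "\<lambda>g. - f g"]) (auto simp: carr add zero)
    qed (simp_all add: add_carr, auto simp: carr add zero algebra_simps)
    show "monoid ?R"
    proof (rule monoidI)
      fix f h k
      assume f: "f \<in> carrier ?R" and h: "h \<in> carrier ?R" and k: "k \<in> carrier ?R"
      let ?U = "(\<lambda>(x, y). x \<otimes>\<^bsub>G\<^esub> y) ` (?S f \<times> ?S h)"
      let ?V = "(\<lambda>(x, y). x \<otimes>\<^bsub>G\<^esub> y) ` (?S h \<times> ?S k)"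
      have fin: "finite (?S f)" "finite (?S h)" "finite (?S k)" "finite ?U" "finite ?V"
        using f h k by (auto simp: carr)
      have SU: "?S (f \<otimes>\<^bsub>?R\<^esub> h) \<subseteq> ?U" and SV: "?S (h \<otimes>\<^bsub>?R\<^esub> k) \<subseteq> ?V"
        by (intro group_algebra_mult_supp fin order_refl)+
      show "f \<otimes>\<^bsub>?R\<^esub> h \<otimes>\<^bsub>?R\<^esub> k = f \<otimes>\<^bsub>?R\<^esub> (h \<otimes>\<^bsub>?R\<^esub> k)"
      proof
        fix g
        have "(f \<otimes>\<^bsub>?R\<^esub> h \<otimes>\<^bsub>?R\<^esub> k) g =
            (\<Sum>u\<in>?U. \<Sum>z\<in>?S k. if u \<otimes>\<^bsub>G\<^esub> z = g then (f \<otimes>\<^bsub>?R\<^esub> h) u * k z else 0)"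
          by (intro group_algebra_mult_eq fin SU order_refl)
        also have "\<dots> = (\<Sum>u\<in>?U. (f \<otimes>\<^bsub>?R\<^esub> h) u * (\<Sum>z\<in>?S k. if u \<otimes>\<^bsub>G\<^esub> z = g then k z else 0))"
          unfolding sum_distrib_left by (intro sum.cong refl) simp
        also have "\<dots> = (\<Sum>x\<in>?S f. \<Sum>y\<in>?S h. f x * h y *
            (\<Sum>z\<in>?S k. if (x \<otimes>\<^bsub>G\<^esub> y) \<otimes>\<^bsub>G\<^esub> z = g then k z else 0))"
          by (rule group_algebra_mult_sum[OF fin(1) order_refl fin(2) order_refl refl])
        also have "\<dots> = (\<Sum>x\<in>?S f. \<Sum>y\<in>?S h. \<Sum>z\<in>?S k.
            h y * k z * (if x \<otimes>\<^bsub>G\<^esub> (y \<otimes>\<^bsub>G\<^esub> z) = g then f x else 0))"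
          unfolding sum_distrib_left
        proof (intro sum.cong refl)
          fix x y z assume "x \<in> ?S f" "y \<in> ?S h" "z \<in> ?S k"
          then have "(x \<otimes>\<^bsub>G\<^esub> y) \<otimes>\<^bsub>G\<^esub> z = x \<otimes>\<^bsub>G\<^esub> (y \<otimes>\<^bsub>G\<^esub> z)"
            using f h k by (intro G.m_assoc) (auto simp: carr)
          then show "f x * h y * (if x \<otimes>\<^bsub>G\<^esub> y \<otimes>\<^bsub>G\<^esub> z = g then k z else 0) =
              h y * k z * (if x \<otimes>\<^bsub>G\<^esub> (y \<otimes>\<^bsub>G\<^esub> z) = g then f x else 0)"
            by simp
        qed
        also have "\<dots> = (\<Sum>x\<in>?S f. \<Sum>v\<in>?V. (h \<otimes>\<^bsub>?R\<^esub> k) v *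
            (if x \<otimes>\<^bsub>G\<^esub> v = g then f x else 0))"
          by (intro sum.cong refl
              group_algebra_mult_sum[OF fin(2) order_refl fin(3) order_refl refl, symmetric])
        also have "\<dots> = (\<Sum>x\<in>?S f. \<Sum>v\<in>?V. if x \<otimes>\<^bsub>G\<^esub> v = g then f x * (h \<otimes>\<^bsub>?R\<^esub> k) v else 0)"
          by (intro sum.cong refl) simp
        also have "\<dots> = (f \<otimes>\<^bsub>?R\<^esub> (h \<otimes>\<^bsub>?R\<^esub> k)) g"
          by (intro group_algebra_mult_eq[symmetric] fin SV order_refl)
        finally show "(f \<otimes>\<^bsub>?R\<^esub> h \<otimes>\<^bsub>?R\<^esub> k) g = (f \<otimes>\<^bsub>?R\<^esub> (h \<otimes>\<^bsub>?R\<^esub> k)) g" .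
      qed
    next
      fix f assume f: "f \<in> carrier ?R"
      then have fin: "finite (?S f)" and sub: "?S f \<subseteq> carrier G" by (auto simp: carr)
      have one1: "\<one>\<^bsub>?R\<^esub> \<one>\<^bsub>G\<^esub> = 1" by (simp add: one)
      have S1: "?S \<one>\<^bsub>?R\<^esub> \<subseteq> {\<one>\<^bsub>G\<^esub>}" by (auto simp: one)
      show "\<one>\<^bsub>?R\<^esub> \<otimes>\<^bsub>?R\<^esub> f = f"
      proof
        fix g
        have "(\<one>\<^bsub>?R\<^esub> \<otimes>\<^bsub>?R\<^esub> f) g =
            (\<Sum>x\<in>{\<one>\<^bsub>G\<^esub>}. \<Sum>y\<in>?S f. if x \<otimes>\<^bsub>G\<^esub> y = g then \<one>\<^bsub>?R\<^esub> x * f y else 0)"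
          by (intro group_algebra_mult_eq fin S1 order_refl) simp
        also have "\<dots> = (\<Sum>y\<in>?S f. if y = g then f y else 0)"
          using sub one1 by (auto intro!: sum.cong)
        also have "\<dots> = f g" using fin by simp
        finally show "(\<one>\<^bsub>?R\<^esub> \<otimes>\<^bsub>?R\<^esub> f) g = f g" .
      qed
      show "f \<otimes>\<^bsub>?R\<^esub> \<one>\<^bsub>?R\<^esub> = f"
      proof
        fix g
        have "(f \<otimes>\<^bsub>?R\<^esub> \<one>\<^bsub>?R\<^esub>) g =
            (\<Sum>x\<in>?S f. \<Sum>y\<in>{\<one>\<^bsub>G\<^esub>}. if x \<otimes>\<^bsub>G\<^esub> y = g then f x * \<one>\<^bsub>?R\<^esub> y else 0)"
          by (intro group_algebra_mult_eq fin S1 order_refl) simp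
        also have "\<dots> = (\<Sum>x\<in>?S f. if x = g then f x else 0)"
          using sub one1 by (auto intro!: sum.cong)
        also have "\<dots> = f g" using fin by simp
        finally show "(f \<otimes>\<^bsub>?R\<^esub> \<one>\<^bsub>?R\<^esub>) g = f g" .
      qed
    qed (simp_all add: mult_carr one_carr)
  next
    fix f h k
    assume f: "f \<in> carrier ?R" and h: "h \<in> carrier ?R" and k: "k \<in> carrier ?R"
    let ?A = "?S f \<union> ?S h"
    have fin: "finite ?A" "finite (?S k)" using f h k by (auto simp: carr)
    have sub: "?S f \<subseteq> ?A" "?S h \<subseteq> ?A" by auto
    show "(f \<oplus>\<^bsub>?R\<^esub> h) \<otimes>\<^bsub>?R\<^esub> k = f \<otimes>\<^bsub>?R\<^esub> k \<oplus>\<^bsub>?R\<^esub> h \<otimes>\<^bsub>?R\<^esub> k"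
    proof
      fix g
      have "((f \<oplus>\<^bsub>?R\<^esub> h) \<otimes>\<^bsub>?R\<^esub> k) g = (\<Sum>x\<in>?A. \<Sum>y\<in>?S k. if x \<otimes>\<^bsub>G\<^esub> y = g then (f \<oplus>\<^bsub>?R\<^esub> h) x * k y else 0)"
        by (rule group_algebra_mult_eq[OF fin(1) Sadd fin(2) order_refl])
      also have "\<dots> = (\<Sum>x\<in>?A. \<Sum>y\<in>?S k. if x \<otimes>\<^bsub>G\<^esub> y = g then f x * k y else 0) +
          (\<Sum>x\<in>?A. \<Sum>y\<in>?S k. if x \<otimes>\<^bsub>G\<^esub> y = g then h x * k y else 0)"
        unfolding sum.distrib[symmetric] by (intro sum.cong refl) (simp add: add distrib_left distrib_right)
      also have "\<dots> = (f \<otimes>\<^bsub>?R\<^esub> k) g + (h \<otimes>\<^bsub>?R\<^esub> k) g"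
        by (simp only: group_algebra_mult_eq[OF fin(1) sub(1) fin(2) order_refl]
            group_algebra_mult_eq[OF fin(1) sub(2) fin(2) order_refl])
      finally show "((f \<oplus>\<^bsub>?R\<^esub> h) \<otimes>\<^bsub>?R\<^esub> k) g = (f \<otimes>\<^bsub>?R\<^esub> k \<oplus>\<^bsub>?R\<^esub> h \<otimes>\<^bsub>?R\<^esub> k) g"
        by (simp add: add)
    qed
    show "k \<otimes>\<^bsub>?R\<^esub> (f \<oplus>\<^bsub>?R\<^esub> h) = k \<otimes>\<^bsub>?R\<^esub> f \<oplus>\<^bsub>?R\<^esub> k \<otimes>\<^bsub>?R\<^esub> h"
    proof
      fix g
      have "(k \<otimes>\<^bsub>?R\<^esub> (f \<oplus>\<^bsub>?R\<^esub> h)) g = (\<Sum>x\<in>?S k. \<Sum>y\<in>?A. if x \<otimes>\<^bsub>G\<^esub> y = g then k x * (f \<oplus>\<^bsub>?R\<^esub> h) y else 0)"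
        by (rule group_algebra_mult_eq[OF fin(2) order_refl fin(1) Sadd])
      also have "\<dots> = (\<Sum>x\<in>?S k. \<Sum>y\<in>?A. if x \<otimes>\<^bsub>G\<^esub> y = g then k x * f y else 0) +
          (\<Sum>x\<in>?S k. \<Sum>y\<in>?A. if x \<otimes>\<^bsub>G\<^esub> y = g then k x * h y else 0)"
        unfolding sum.distrib[symmetric] by (intro sum.cong refl) (simp add: add distrib_left distrib_right)
      also have "\<dots> = (k \<otimes>\<^bsub>?R\<^esub> f) g + (k \<otimes>\<^bsub>?R\<^esub> h) g"
        by (simp only: group_algebra_mult_eq[OF fin(2) order_refl fin(1) sub(1)]
            group_algebra_mult_eq[OF fin(2) order_refl fin(1) sub(2)])
      finally show "(k \<otimes>\<^bsub>?R\<^esub> (f \<oplus>\<^bsub>?R\<^esub> h)) g = (k \<otimes>\<^bsub>?R\<^esub> f \<oplus>\<^bsub>?R\<^esub> k \<otimes>\<^bsub>?R\<^esub> h) g"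
        by (simp add: add)
    qed
  qed
qed

text \<open>
  Closure under negation, required by \<^const>\<open>ideal\<close>, is automatic in a ring with unit.
\<close>

lemma (in ring) ideal_iff_closed:
  "ideal I R \<longleftrightarrow> I \<subseteq> carrier R \<and> I \<noteq> {} \<and> (\<forall>a\<in>I. \<forall>b\<in>I. a \<oplus> b \<in> I) \<and>
     (\<forall>a\<in>I. \<forall>x\<in>carrier R. x \<otimes> a \<in> I \<and> a \<otimes> x \<in> I)"
proof
  assume "ideal I R"
  then interpret I: ideal I R .
  show "I \<subseteq> carrier R \<and> I \<noteq> {} \<and> (\<forall>a\<in>I. \<forall>b\<in>I. a \<oplus> b \<in> I) \<and>
     (\<forall>a\<in>I. \<forall>x\<in>carrier R. x \<otimes> a \<in> I \<and> a \<otimes> x \<in> I)"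
    using I.a_subset I.zero_closed I.a_closed I.I_l_closed I.I_r_closed
    by (auto simp del: I.zero_closed)
next
  assume *: "I \<subseteq> carrier R \<and> I \<noteq> {} \<and> (\<forall>a\<in>I. \<forall>b\<in>I. a \<oplus> b \<in> I) \<and>
     (\<forall>a\<in>I. \<forall>x\<in>carrier R. x \<otimes> a \<in> I \<and> a \<otimes> x \<in> I)"
  show "ideal I R"
  proof (rule idealI)
    show "subgroup I (add_monoid R)"
    proof (rule add.subgroupI)
      fix a assume a: "a \<in> I"
      then have "(\<ominus> \<one>) \<otimes> a \<in> I" using * by blast
      moreover have "(\<ominus> \<one>) \<otimes> a = \<ominus> a" using a * l_minus[of \<one> a] by auto
      ultimately show "\<ominus> a \<in> I" by simp
    qed (use * in auto)
  qed (use * in \<open>auto intro: ring_axioms\<close>)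
qed

end

theory Submission
  imports Defs "HOL-Library.Extended_Nat" "HOL-Library.Poly_Mapping"
begin

text \<open>
  Every ideal \<open>I\<close> of the group algebra is determined by the finite Young diagrams whose Young
  symmetrizer (column antisymmetrizer times row symmetrizer) lies outside \<open>I\<close>. They are closed under
  taking subdiagrams, since the symmetrizer of a larger diagram is a multiple \<open>y c z\<close> of the
  symmetrizer \<open>c\<close> of a smaller one. Downward closed sets of finite Young diagrams are well-quasi-ordered
  by inclusion: such a set is a finite union of directed ones, a directed one is given by a possibly
  infinite diagram, and a possibly infinite diagram is in turn a finite union of possibly
  infinite rectangles.

  That the diagrams determine the ideal is the representation theory of the symmetric group of a finite
  set \<open>X\<close> of points, over an arbitrary field of characteristic 0. By Maschke's theorem, one-sided ideals
  have idempotent generators. As \<open>c y c\<close> is always a scalar multiple of the Young symmetrizer \<open>c\<close>, an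
  ideal either contains \<open>c\<close> or is annihilated by it. It remains to see that 1 lies in the ideal \<open>W\<close>
  generated by the Young symmetrizers on \<open>X\<close>. One shows that \<open>W\<close> contains all row symmetrizers,
  proceeding from larger to smaller shapes: an element that is invariant under the row group and
  killed by the row symmetrizers of lexicographically larger shapes has a lattice word as leading
  word, and subtracting a translate of the corresponding Young symmetrizer lowers that word.
\<close>

section \<open>Well-quasi-orders and Young diagrams\<close>

text \<open>Passing to downward closed sets does not preserve well-quasi-orders in general; Rado's
  order is a counterexample. The directed sets are therefore computed explicitly on two levels, for
  cells and for finite diagrams, and each time they are coded by an order already known to be a
  well-quasi-order. No irreducible module is classified and no dimension is counted. What is needed
  about finite symmetric groups is that the Young symmetrizers generate the whole algebra as a
  two-sided ideal. Row symmetrizers serve as stepping stones because the shape with all rows of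
  length one has trivial row group, so that its row symmetrizer is 1. Maschke's theorem enters
  twice: it turns congruences modulo \<open>W\<close> into exact equations, and it turns the scalar
  in \<open>c y c\<close> into the annihilation of an ideal.\<close>

definition wqo_on :: "('a \<Rightarrow> 'a \<Rightarrow> bool) \<Rightarrow> 'a set \<Rightarrow> bool" where
  "wqo_on rel Q \<longleftrightarrow> (\<forall>f :: nat \<Rightarrow> 'a. (\<forall>n. f n \<in> Q) \<longrightarrow> (\<exists>i j. i < j \<and> rel (f i) (f j)))"

lemma wqo_onD:
  assumes "wqo_on rel Q" "\<And>n. f n \<in> Q"
  obtains i j :: nat where "i < j" "rel (f i) (f j)"
  using assms unfolding wqo_on_def by blast

lemma wqo_on_subset: "wqo_on rel Q \<Longrightarrow> P \<subseteq> Q \<Longrightarrow> wqo_on rel P"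
  unfolding wqo_on_def by blast

lemma wqo_on_vimage:
  assumes "wqo_on rel Q" "\<And>x. x \<in> P \<Longrightarrow> h x \<in> Q"
    and "\<And>x y. x \<in> P \<Longrightarrow> y \<in> P \<Longrightarrow> rel (h x) (h y) \<Longrightarrow> rel' x y"
  shows "wqo_on rel' P"
  unfolding wqo_on_def
proof (intro allI impI)
  fix f :: "nat \<Rightarrow> _" assume f: "\<forall>n. f n \<in> P"
  obtain i j :: nat where "i < j" "rel (h (f i)) (h (f j))"
    using wqo_onD[OF assms(1), of "\<lambda>n. h (f n)"] assms(2) f by blast
  then show "\<exists>i j. i < j \<and> rel' (f i) (f j)"
    using assms(3) f by blast
qed

text \<open>In a bad sequence every \<open>F i\<close> has, for each later \<open>j\<close>, an
  element with nothing above it in \<open>F j\<close>. As \<open>F i\<close> is finite, one element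
  serves infinitely many \<open>j\<close>. Choosing the next index among those \<open>j\<close>,
  again and again, produces a bad sequence of elements.\<close>

lemma wqo_on_finite_sets:
  assumes "wqo_on rel Q"
  shows "wqo_on (\<lambda>A B. \<forall>a\<in>A. \<exists>b\<in>B. rel a b) {A. finite A \<and> A \<subseteq> Q}"
  unfolding wqo_on_def
proof (intro allI impI, rule ccontr)
  fix F :: "nat \<Rightarrow> 'a set"
  assume F: "\<forall>n. F n \<in> {A. finite A \<and> A \<subseteq> Q}"
    and bad: "\<not> (\<exists>i j. i < j \<and> (\<forall>a\<in>F i. \<exists>b\<in>F j. rel a b))"
  \<comment> \<open>\<open>M\<close> is the reservoir of later indices whose sets contain nothing
    above \<open>a\<close>; the next index is drawn from it.\<close>
  define P where "P = (\<lambda>(i, a, M). a \<in> F i \<and> infinite M \<and> (\<forall>j\<in>M. \<forall>b\<in>F j. \<not> rel a b))"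
  have ex: "\<exists>a M'. P (i, a, M') \<and> M' \<subseteq> M" if M: "infinite M" for i :: nat and M
  proof -
    let ?M = "M \<inter> {i<..}"
    have "M \<subseteq> ?M \<union> {..i}" by auto
    then have inf: "infinite ?M"
      using M by (meson finite_UnI finite_atMost finite_subset)
    have "\<exists>a. j \<in> ?M \<longrightarrow> a \<in> F i \<and> (\<forall>b\<in>F j. \<not> rel a b)" for j
      using bad by blast
    then obtain h where h: "\<And>j. j \<in> ?M \<Longrightarrow> h j \<in> F i \<and> (\<forall>b\<in>F j. \<not> rel (h j) b)"
      by metis
    have "h ` ?M \<subseteq> F i" using h by blast
    moreover have "finite (F i)" using F by simp
    ultimately have "finite (h ` ?M)" by (rule finite_subset)
    then obtain j where "j \<in> ?M" "infinite {k \<in> ?M. h k = h j}"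
      using pigeonhole_infinite[OF inf, of h] by auto
    moreover have "\<not> rel (h j) b" if "k \<in> {k \<in> ?M. h k = h j}" "b \<in> F k" for k b
      using that h[of k] by simp
    ultimately have "P (i, h j, {k \<in> ?M. h k = h j})"
      unfolding P_def prod.case using h[of j] by blast
    then show ?thesis by blast
  qed
  have "\<exists>f. \<forall>n :: nat. P (f n) \<and> fst (f (Suc n)) \<in> snd (snd (f n)) \<and>
      snd (snd (f (Suc n))) \<subseteq> snd (snd (f n))"
  proof (rule dependent_nat_choice[where P = "\<lambda>n. P"
        and Q = "\<lambda>n s t. fst t \<in> snd (snd s) \<and> snd (snd t) \<subseteq> snd (snd s)"])
    show "\<exists>x. P x" using ex[of UNIV] by blast
  next
    fix s and n :: nat assume "P s"
    then have "infinite (snd (snd s))" by (auto simp: P_def)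
    moreover then obtain i where "i \<in> snd (snd s)" by fastforce
    ultimately obtain a M where "P (i, a, M)" "M \<subseteq> snd (snd s)" using ex by blast
    then show "\<exists>t. P t \<and> fst t \<in> snd (snd s) \<and> snd (snd t) \<subseteq> snd (snd s)"
      using \<open>i \<in> snd (snd s)\<close> by (intro exI[of _ "(i, a, M)"]) auto
  qed
  then obtain f where Pf: "\<And>n. P (f n)"
    and step: "\<And>n. fst (f (Suc n)) \<in> snd (snd (f n))" "\<And>n. snd (snd (f (Suc n))) \<subseteq> snd (snd (f n))"
    by blast
  have dec: "snd (snd (f n)) \<subseteq> snd (snd (f m))" if "m \<le> n" for m n
    using that step(2) by (rule lift_Suc_antimono_le[where f = "\<lambda>n. snd (snd (f n))", rotated])
  have inF: "fst (snd (f n)) \<in> F (fst (f n))" for n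
    using Pf[of n] by (auto simp: P_def)
  then have "fst (snd (f n)) \<in> Q" for n using F by blast
  then obtain m n :: nat where mn: "m < n" "rel (fst (snd (f m))) (fst (snd (f n)))"
    by (rule wqo_onD[OF assms, of "\<lambda>n. fst (snd (f n))"])
  obtain k where k: "n = Suc k" "m \<le> k" using mn(1) by (cases n) auto
  then have "fst (f n) \<in> snd (snd (f m))"
    using step(1)[of k] dec[of m k] by auto
  then show False
    using Pf[of m] mn(2) inF[of n] by (auto simp: P_def)
qed

section \<open>Downward closed sets and their directed components\<close>

definition downset :: "('a \<Rightarrow> 'a \<Rightarrow> bool) \<Rightarrow> 'a set \<Rightarrow> 'a set \<Rightarrow> bool" where
  "downset rel Q D \<longleftrightarrow> D \<subseteq> Q \<and> (\<forall>x\<in>D. \<forall>y\<in>Q. rel y x \<longrightarrow> y \<in> D)"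

definition directed :: "('a \<Rightarrow> 'a \<Rightarrow> bool) \<Rightarrow> 'a set \<Rightarrow> bool" where
  "directed rel D \<longleftrightarrow> D \<noteq> {} \<and> (\<forall>x\<in>D. \<forall>y\<in>D. \<exists>z\<in>D. rel x z \<and> rel y z)"

text \<open>Pick an element lost at each step of a strictly decreasing chain. A comparison between
  an earlier and a later one would put the earlier one back into a set that has already lost
  it.\<close>

lemma wf_downsets:
  assumes "wqo_on rel Q"
  shows "wf {(D', D). downset rel Q D' \<and> downset rel Q D \<and> D' \<subset> D}"
  unfolding wf_iff_no_infinite_down_chain
proof
  assume "\<exists>f. \<forall>i. (f (Suc i), f i) \<in> {(D', D). downset rel Q D' \<and> downset rel Q D \<and> D' \<subset> D}"
  then obtain f :: "nat \<Rightarrow> _" where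
    "\<forall>i. (f (Suc i), f i) \<in> {(D', D). downset rel Q D' \<and> downset rel Q D \<and> D' \<subset> D}" by blast
  then have f: "downset rel Q (f i)" "f (Suc i) \<subset> f i" for i by simp_all
  then have "\<forall>i. \<exists>x. x \<in> f i \<and> x \<notin> f (Suc i)" by blast
  then obtain x where x: "\<And>i. x i \<in> f i" "\<And>i. x i \<notin> f (Suc i)" by metis
  have "x n \<in> Q" for n using x(1) f(1) by (auto simp: downset_def)
  then obtain i j :: nat where ij: "i < j" "rel (x i) (x j)"
    by (rule wqo_onD[OF assms])
  have "f j \<subseteq> f (Suc i)"
  proof (rule lift_Suc_antimono_le[of f])
    show "f (Suc n) \<subseteq> f n" for n using f(2)[of n] by blast
  qed (use ij(1) in simp)
  then have "x j \<in> f (Suc i)" using x(1) by blast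
  moreover have "x i \<in> Q" by fact
  ultimately have "x i \<in> f (Suc i)"
    using f(1)[of "Suc i"] ij(2) unfolding downset_def by blast
  with x(2) show False by blast
qed

text \<open>Noetherian induction: if \<open>x\<close> and \<open>y\<close> have no common upper
  bound in \<open>D\<close>, every element fails to be above one of them, so \<open>D\<close> is the
  union of two strictly smaller downward closed sets.\<close>

lemma downset_finite_union_directed:
  assumes wqo: "wqo_on rel Q" and trans: "\<And>x y z. rel x y \<Longrightarrow> rel y z \<Longrightarrow> rel x z"
    and refl: "\<And>x. rel x x" and "downset rel Q D"
  shows "\<exists>F. finite F \<and> (\<forall>E\<in>F. downset rel Q E \<and> directed rel E) \<and> D = \<Union>F"
  using \<open>downset rel Q D\<close>
proof (induction D rule: wf_induct_rule[OF wf_downsets[OF wqo]])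
  case (1 D)
  show ?case
  proof (cases "D = {} \<or> directed rel D")
    case True
    then show ?thesis
    proof
      assume "D = {}" then show ?thesis by (intro exI[of _ "{}"]) auto
    next
      assume "directed rel D" then show ?thesis using 1 by (intro exI[of _ "{D}"]) auto
    qed
  next
    case False
    then obtain x y where xy: "x \<in> D" "y \<in> D" "\<And>z. z \<in> D \<Longrightarrow> \<not> (rel x z \<and> rel y z)"
      by (auto simp: directed_def)
    have less: "\<exists>F. finite F \<and> (\<forall>E\<in>F. downset rel Q E \<and> directed rel E) \<and> {z \<in> D. \<not> rel u z} = \<Union>F"
      if "u \<in> D" for u
    proof (rule 1)
      show d: "downset rel Q {z \<in> D. \<not> rel u z}"
        using 1(2) trans unfolding downset_def by blast
      have "u \<in> D - {z \<in> D. \<not> rel u z}" using that refl by auto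
      then show "({z \<in> D. \<not> rel u z}, D) \<in> {(D', D). downset rel Q D' \<and> downset rel Q D \<and> D' \<subset> D}"
        using d 1(2) by auto
    qed
    obtain F1 where F1: "finite F1" "\<forall>E\<in>F1. downset rel Q E \<and> directed rel E" "{z \<in> D. \<not> rel x z} = \<Union>F1"
      using less[OF xy(1)] by blast
    obtain F2 where F2: "finite F2" "\<forall>E\<in>F2. downset rel Q E \<and> directed rel E" "{z \<in> D. \<not> rel y z} = \<Union>F2"
      using less[OF xy(2)] by blast
    have "D = {z \<in> D. \<not> rel x z} \<union> {z \<in> D. \<not> rel y z}" using xy(3) by auto
    then have "D = \<Union>(F1 \<union> F2)" using F1(3) F2(3) by auto
    then show ?thesis using F1 F2 by (intro exI[of _ "F1 \<union> F2"]) auto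
  qed
qed

text \<open>
  A downward closed set is a finite union of directed ones, so inclusion of downward closed
  sets reflects domination of finite sets of directed ones.
\<close>

lemma wqo_on_downsets:
  assumes "wqo_on rel Q" "\<And>x y z. rel x y \<Longrightarrow> rel y z \<Longrightarrow> rel x z" "\<And>x. rel x x"
    and dir: "wqo_on (\<subseteq>) {E. downset rel Q E \<and> directed rel E}"
  shows "wqo_on (\<subseteq>) {D. downset rel Q D}"
proof -
  have "\<exists>F. downset rel Q D \<longrightarrow>
      finite F \<and> (\<forall>E\<in>F. downset rel Q E \<and> directed rel E) \<and> D = \<Union>F" for D
    using downset_finite_union_directed[OF assms(1), of D] assms(2,3) by metis
  then obtain F where F: "\<And>D. downset rel Q D \<Longrightarrow>
      finite (F D) \<and> (\<forall>E\<in>F D. downset rel Q E \<and> directed rel E) \<and> D = \<Union>(F D)"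
    by metis
  show ?thesis
  proof (rule wqo_on_vimage[OF wqo_on_finite_sets[OF dir], of _ F])
    fix D D' assume "D \<in> {D. downset rel Q D}" "D' \<in> {D. downset rel Q D}"
      and dom: "\<forall>a\<in>F D. \<exists>b\<in>F D'. a \<subseteq> b"
    then have "D = \<Union>(F D)" "D' = \<Union>(F D')" using F by auto
    then show "D \<subseteq> D'" using dom by blast
  qed (use F in blast)
qed

text \<open>Some subsequence is monotone. If it decreases, it is constant from the point where it
  attains its least value.\<close>

lemma wellorder_mono_subseq:
  fixes s :: "nat \<Rightarrow> 'a::wellorder"
  shows "\<exists>r :: nat \<Rightarrow> nat. strict_mono r \<and> (\<forall>m n. m \<le> n \<longrightarrow> s (r m) \<le> s (r n))"
proof -
  obtain r where r: "strict_mono r" "monoseq (\<lambda>n. s (r n))"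
    using seq_monosub[of s] by blast
  show ?thesis
  proof (cases "\<forall>m n. m \<le> n \<longrightarrow> s (r m) \<le> s (r n)")
    case True then show ?thesis using r by blast
  next
    case False
    with r(2) have anti: "\<And>m n. m \<le> n \<Longrightarrow> s (r n) \<le> s (r m)" unfolding monoseq_def by blast
    define v where "v = (LEAST v. \<exists>n. v = s (r n))"
    have "\<exists>n. v = s (r n)" unfolding v_def by (rule LeastI_ex) blast
    then obtain N where N: "v = s (r N)" by blast
    have "s (r (n + N)) = v" for n
    proof (rule antisym)
      show "s (r (n + N)) \<le> v" using anti[of N "n + N"] N by simp
      show "v \<le> s (r (n + N))" unfolding v_def by (rule Least_le) blast
    qed
    moreover have "strict_mono (\<lambda>n. r (n + N))"
      using r(1) by (simp add: strict_mono_def)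
    ultimately show ?thesis by (intro exI[of _ "\<lambda>n. r (n + N)"]) simp
  qed
qed

text \<open>Dickson's lemma for two factors. General well-orders are allowed because it is applied
  to pairs over \<open>nat\<close> and over \<open>enat\<close>.\<close>

lemma wqo_on_pair:
  "wqo_on (\<lambda>x y. fst x \<le> fst y \<and> snd x \<le> snd y) (UNIV :: ('a::wellorder \<times> 'b::wellorder) set)"
  unfolding wqo_on_def
proof (intro allI impI)
  fix f :: "nat \<Rightarrow> 'a \<times> 'b"
  obtain r :: "nat \<Rightarrow> nat" where r: "strict_mono r \<and> (\<forall>m n. m \<le> n \<longrightarrow> fst (f (r m)) \<le> fst (f (r n)))"
    using wellorder_mono_subseq[of "\<lambda>n. fst (f n)"] by blast
  obtain q :: "nat \<Rightarrow> nat" where q: "strict_mono q \<and> (\<forall>m n. m \<le> n \<longrightarrow> snd (f (r (q m))) \<le> snd (f (r (q n))))"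
    using wellorder_mono_subseq[of "\<lambda>n. snd (f (r n))"] by blast
  have "q 0 < q 1" using q by (simp add: strict_mono_def)
  then have "r (q 0) < r (q 1)" "fst (f (r (q 0))) \<le> fst (f (r (q 1)))"
    using r by (auto simp: strict_mono_def)
  moreover have "snd (f (r (q 0))) \<le> snd (f (r (q 1)))" using q by simp
  ultimately show "\<exists>i j. i < j \<and> fst (f i) \<le> fst (f j) \<and> snd (f i) \<le> snd (f j)"
    by blast
qed

section \<open>Possibly infinite Young diagrams\<close>

abbreviation le_box :: "nat \<times> nat \<Rightarrow> nat \<times> nat \<Rightarrow> bool" where
  "le_box x y \<equiv> fst x \<le> fst y \<and> snd x \<le> snd y"

text \<open>Infinite diagrams are included, since they code the directed families in
  \<open>wqo_on_young_downsets\<close>. Cells are pairs of row and column, counted from 0.\<close>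

definition young :: "(nat \<times> nat) set \<Rightarrow> bool" where
  "young D \<longleftrightarrow> downset le_box UNIV D"

lemma enat_le_SUP_iff:
  assumes "E \<noteq> {}"
  shows "enat n \<le> (SUP x\<in>E. enat (h x)) \<longleftrightarrow> (\<exists>x\<in>E. n \<le> h x)"
proof (cases n)
  case 0
  then show ?thesis using assms by (auto simp flip: zero_enat_def)
next
  case (Suc m)
  have "enat n \<le> (SUP x\<in>E. enat (h x)) \<longleftrightarrow> enat m < (SUP x\<in>E. enat (h x))"
    using Suc by (simp add: Suc_ile_eq)
  then show ?thesis using Suc by (simp add: less_SUP_iff Suc_le_eq)
qed

text \<open>A directed downward closed set of cells is a rectangle with sides in
  \<open>enat\<close>, determined by the suprema of its coordinates: directedness combines a witness
  for the row and a witness for the column into one cell.\<close>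

lemma wqo_on_young: "wqo_on (\<subseteq>) {D. young D}"
  unfolding young_def
proof (rule wqo_on_downsets)
  show "wqo_on le_box UNIV" by (rule wqo_on_pair)
  let ?h = "\<lambda>E :: (nat \<times> nat) set. (SUP x\<in>E. enat (fst x), SUP x\<in>E. enat (snd x))"
  show "wqo_on (\<subseteq>) {E. downset le_box UNIV E \<and> directed le_box E}"
  proof (rule wqo_on_vimage[where h = ?h, OF wqo_on_pair])
    fix D E assume D: "D \<in> {E. downset le_box UNIV E \<and> directed le_box E}"
      and E: "E \<in> {E. downset le_box UNIV E \<and> directed le_box E}"
      and le: "fst (?h D) \<le> fst (?h E) \<and> snd (?h D) \<le> snd (?h E)"
    have E': "E \<noteq> {}" "\<And>x y. x \<in> E \<Longrightarrow> y \<in> E \<Longrightarrow> \<exists>z\<in>E. le_box x z \<and> le_box y z"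
      "\<And>x y. x \<in> E \<Longrightarrow> le_box y x \<Longrightarrow> y \<in> E"
      using E by (auto simp: directed_def downset_def)
    show "D \<subseteq> E"
    proof
      fix x assume x: "x \<in> D"
      have "enat (fst x) \<le> fst (?h D)" "enat (snd x) \<le> snd (?h D)"
        using x by (auto intro: SUP_upper)
      then have "enat (fst x) \<le> (SUP x\<in>E. enat (fst x))" "enat (snd x) \<le> (SUP x\<in>E. enat (snd x))"
        using le by (auto intro: order_trans)
      then obtain u v where uv: "u \<in> E" "fst x \<le> fst u" "v \<in> E" "snd x \<le> snd v"
        unfolding enat_le_SUP_iff[OF E'(1)] by blast
      then obtain z where "z \<in> E" "le_box u z" "le_box v z" using E'(2) by blast
      then show "x \<in> E" using uv E'(3)[of z x] by auto
    qed
  qed simp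
qed auto

lemma directed_finite_subset:
  assumes "directed (\<subseteq>) E" "finite A" "A \<subseteq> \<Union>E"
  shows "\<exists>B\<in>E. A \<subseteq> B"
  using assms(2,3)
proof (induction A rule: finite_induct)
  case empty
  then show ?case using assms(1) by (auto simp: directed_def)
next
  case (insert x A)
  then obtain B C where "B \<in> E" "A \<subseteq> B" "C \<in> E" "x \<in> C" by auto
  moreover then obtain Z where "Z \<in> E" "B \<subseteq> Z" "C \<subseteq> Z"
    using assms(1) unfolding directed_def by blast
  ultimately show ?case by blast
qed

text \<open>A directed family of finite diagrams is recovered from its union: a finite diagram
  inside the union already lies inside a single member.\<close>

lemma wqo_on_young_downsets:
  "wqo_on (\<subseteq>) {E. downset (\<subseteq>) {D. finite D \<and> young D} E}"
proof (rule wqo_on_downsets)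
  let ?Q = "{D. finite D \<and> young D}"
  show "wqo_on (\<subseteq>) ?Q" by (rule wqo_on_subset[OF wqo_on_young]) auto
  show "wqo_on (\<subseteq>) {E. downset (\<subseteq>) ?Q E \<and> directed (\<subseteq>) E}"
  proof (rule wqo_on_vimage[OF wqo_on_young, of _ Union])
    fix E assume "E \<in> {E. downset (\<subseteq>) ?Q E \<and> directed (\<subseteq>) E}"
    then have "young D" if "D \<in> E" for D using that by (auto simp: downset_def)
    then show "\<Union>E \<in> {D. young D}"
      unfolding young_def downset_def by (simp, meson)
  next
    fix E E' assume E: "E \<in> {E. downset (\<subseteq>) ?Q E \<and> directed (\<subseteq>) E}"
      and E': "E' \<in> {E. downset (\<subseteq>) ?Q E \<and> directed (\<subseteq>) E}" and sub: "\<Union>E \<subseteq> \<Union>E'"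
    show "E \<subseteq> E'"
    proof
      fix D assume D: "D \<in> E"
      then have "D \<in> ?Q" using E by (auto simp: downset_def)
      moreover have "\<exists>B\<in>E'. D \<subseteq> B"
        by (rule directed_finite_subset) (use D E' sub \<open>D \<in> ?Q\<close> in auto)
      ultimately show "D \<in> E'" using E' by (auto simp: downset_def)
    qed
  qed
qed auto

section \<open>Group algebras and averaging\<close>

abbreviation "lookup \<equiv> Poly_Mapping.lookup"
abbreviation "single \<equiv> Poly_Mapping.single"
abbreviation "keys \<equiv> Poly_Mapping.keys"

lemma poly_mapping_sum_single:
  fixes x :: "'g \<Rightarrow>\<^sub>0 'k::comm_monoid_add"
  assumes "finite A" "keys x \<subseteq> A"
  shows "x = (\<Sum>g\<in>A. single g (lookup x g))"
proof (rule poly_mapping_eqI)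
  fix h
  have "lookup (\<Sum>g\<in>A. single g (lookup x g)) h = (\<Sum>g\<in>A. if g = h then lookup x h else 0)"
    unfolding lookup_sum by (intro sum.cong refl) (simp add: lookup_single when_def)
  also have "\<dots> = lookup x h"
    using assms by (auto simp: in_keys_iff)
  finally show "lookup x h = lookup (\<Sum>g\<in>A. single g (lookup x g)) h" ..
qed

lemma lookup_times_single:
  fixes x :: "'g::group_add \<Rightarrow>\<^sub>0 'k::semiring_1"
  shows "lookup (x * single r k) g = lookup x (g - r) * k"
proof -
  have "x * single r k =
      (\<Sum>h\<in>keys x. single h (lookup x h)) * single r k"
    by (simp flip: poly_mapping_sum_single)
  also have "\<dots> = (\<Sum>h\<in>keys x. single (h + r) (lookup x h * k))"
    by (simp add: sum_distrib_right mult_single)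
  finally have "lookup (x * single r k) g =
      (\<Sum>h\<in>keys x. if h = g - r then lookup x (g - r) * k else 0)"
    by (auto simp: lookup_sum lookup_single when_def diff_eq_eq eq_diff_eq intro!: sum.cong)
  then show ?thesis by (simp add: in_keys_iff)
qed

lemma lookup_single_times:
  fixes x :: "'g::group_add \<Rightarrow>\<^sub>0 'k::semiring_1"
  shows "lookup (single r k * x) g = k * lookup x (- r + g)"
proof -
  have "single r k * x =
      single r k * (\<Sum>h\<in>keys x. single h (lookup x h))"
    by (simp flip: poly_mapping_sum_single)
  also have "\<dots> = (\<Sum>h\<in>keys x. single (r + h) (k * lookup x h))"
    by (simp add: sum_distrib_left mult_single)
  finally have eq: "single r k * x = (\<Sum>h\<in>keys x. single (r + h) (k * lookup x h))" .
  have "r + h = g \<longleftrightarrow> h = - r + g" for h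
    by (auto simp flip: add.assoc)
  then have "lookup (single r k * x) g =
      (\<Sum>h\<in>keys x. if h = - r + g then k * lookup x (- r + g) else 0)"
    unfolding eq lookup_sum by (intro sum.cong refl) (simp add: lookup_single when_def)
  then show ?thesis by (simp add: in_keys_iff)
qed

lemma scalar_commute:
  fixes x :: "'g::group_add \<Rightarrow>\<^sub>0 'k::comm_semiring_1"
  shows "single 0 k * x = x * single 0 k"
  by (rule poly_mapping_eqI) (simp add: lookup_times_single lookup_single_times mult.commute)

section \<open>Finite subgroups and Maschke's theorem\<close>

definition subgrp :: "'g::group_add set \<Rightarrow> bool" where
  "subgrp H \<longleftrightarrow> finite H \<and> 0 \<in> H \<and> (\<forall>a\<in>H. \<forall>b\<in>H. a + b \<in> H) \<and> (\<forall>a\<in>H. - a \<in> H)"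

lemma subgrp_shift_right:
  assumes "subgrp H" "h \<in> H"
  shows "bij_betw (\<lambda>g. g + h) H H"
proof (rule bij_betwI[where g = "\<lambda>g. g + (- h)"])
qed (use assms in \<open>auto simp: subgrp_def add.assoc simp del: add_uminus_conv_diff\<close>)

lemma subgrp_shift_left:
  assumes "subgrp H" "h \<in> H"
  shows "bij_betw (\<lambda>g. h + g) H H"
proof (rule bij_betwI[where g = "\<lambda>g. - h + g"])
qed (use assms in \<open>auto simp: subgrp_def simp flip: add.assoc\<close>)

text \<open>Averaging the conjugates of a linear projection \<open>p\<close> onto \<open>N\<close>
  gives a map that commutes with right multiplication by \<open>H\<close>. On elements supported in
  \<open>H\<close> such a map is left multiplication by its value at 1, and this value is a left
  identity of the right ideal \<open>N\<close>.\<close>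

lemma maschke:
  fixes N :: "('g::group_add \<Rightarrow>\<^sub>0 'k::field_char_0) set"
  assumes H: "subgrp H" and keys: "\<And>x. x \<in> N \<Longrightarrow> keys x \<subseteq> H"
    and zero: "0 \<in> N" and add: "\<And>x y. x \<in> N \<Longrightarrow> y \<in> N \<Longrightarrow> x + y \<in> N"
    and mult: "\<And>x g k. x \<in> N \<Longrightarrow> g \<in> H \<Longrightarrow> x * single g k \<in> N"
  shows "\<exists>f\<in>N. \<forall>x\<in>N. f * x = x"
proof -
  let ?sc = "\<lambda>k (x :: 'g \<Rightarrow>\<^sub>0 'k). single 0 k * x"
  let ?\<delta> = "\<lambda>g :: 'g. single g (1 :: 'k)"
  interpret vs: vector_space ?sc
    by unfold_locales (simp_all add: algebra_simps single_add mult_single flip: mult.assoc)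
  interpret vp: vector_space_pair ?sc ?sc ..
  have fin: "finite H" and H0: "0 \<in> H" and Hm: "\<And>g. g \<in> H \<Longrightarrow> - g \<in> H"
    using H by (auto simp: subgrp_def)
  have "vs.subspace N"
    unfolding vs.subspace_def using zero add mult[OF _ H0] by (auto simp: scalar_commute)
  then obtain p where p: "range p \<subseteq> N" "Vector_Spaces.linear ?sc ?sc p" "\<And>v. v \<in> N \<Longrightarrow> p v = v"
    using vp.linear_exists_left_inverse_on[OF vs.linear_id, of N] by auto
  interpret p: Vector_Spaces.linear ?sc ?sc p by (rule p(2))
  \<comment> \<open>\<open>P\<close> is the sum over the group; the order of the group is divided
    out in \<open>f\<close>.\<close>
  define P where "P x = (\<Sum>g\<in>H. p (x * ?\<delta> (- g)) * ?\<delta> g)" for x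
  define f where "f = P 1 * single 0 (1 / of_nat (card H))"
  have sumN: "(\<Sum>g\<in>S. F g) \<in> N" if "\<And>g. g \<in> S \<Longrightarrow> F g \<in> N" for F :: "'g \<Rightarrow> _" and S
    using that by (induction S rule: infinite_finite_induct) (auto intro: zero add)
  have "P 1 \<in> N"
    unfolding P_def using p(1) by (intro sumN mult) auto
  then have fN: "f \<in> N" unfolding f_def using mult H0 by blast
  have shift: "P 1 * ?\<delta> h = P (?\<delta> h)" if h: "h \<in> H" for h
  proof -
    have "P 1 * ?\<delta> h = (\<Sum>g\<in>H. p (?\<delta> (- g)) * ?\<delta> (g + h))"
      by (simp add: P_def sum_distrib_right mult.assoc mult_single)
    also have "\<dots> = (\<Sum>g\<in>H. p (?\<delta> (h + - (g + h))) * ?\<delta> (g + h))"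
      by (simp add: minus_add flip: add_uminus_conv_diff add.assoc)
    also have "\<dots> = (\<Sum>g\<in>H. p (?\<delta> (h + - g)) * ?\<delta> g)"
      by (rule sum.reindex_bij_betw[OF subgrp_shift_right[OF H h]])
    finally show ?thesis by (simp add: P_def mult_single)
  qed
  have "f * x = x" if x: "x \<in> N" for x
  proof -
    have ex: "x = (\<Sum>h\<in>H. ?sc (lookup x h) (?\<delta> h))"
      using poly_mapping_sum_single[OF fin keys[OF x]] by (simp add: mult_single)
    have "P 1 * x = (\<Sum>h\<in>H. ?sc (lookup x h) (P 1 * ?\<delta> h))"
      by (subst ex) (simp add: sum_distrib_left scalar_commute mult.assoc)
    also have "\<dots> = (\<Sum>h\<in>H. ?sc (lookup x h) (P (?\<delta> h)))"
      by (intro sum.cong refl) (simp add: shift)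
    also have "\<dots> = (\<Sum>h\<in>H. \<Sum>g\<in>H. p (?sc (lookup x h) (?\<delta> h) * ?\<delta> (- g)) * ?\<delta> g)"
      unfolding P_def sum_distrib_left by (simp add: p.scale mult.assoc)
    also have "\<dots> = (\<Sum>g\<in>H. \<Sum>h\<in>H. p (?sc (lookup x h) (?\<delta> h) * ?\<delta> (- g)) * ?\<delta> g)"
      by (rule sum.swap)
    also have "\<dots> = P (\<Sum>h\<in>H. ?sc (lookup x h) (?\<delta> h))"
      unfolding P_def by (simp add: p.sum sum_distrib_right)
    also have "\<dots> = P x" by (simp flip: ex)
    also have "\<dots> = (\<Sum>g\<in>H. x)"
      unfolding P_def using x mult Hm by (intro sum.cong refl) (simp add: p(3) mult.assoc mult_single)
    finally have P1x: "P 1 * x = of_nat (card H) * x" by simp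
    have "f * x = single 0 (1 / of_nat (card H)) * (P 1 * x)"
      by (simp add: f_def mult.assoc flip: scalar_commute)
    also have "\<dots> = single 0 (1 / of_nat (card H) * of_nat (card H)) * x"
    proof -
      have "of_nat (card H) * x = single 0 (of_nat (card H)) * x" by simp
      then show ?thesis unfolding P1x by (simp only: mult_single mult.assoc[symmetric] add_0)
    qed
    also have "1 / of_nat (card H) * of_nat (card H) = (1 :: 'k)"
    proof -
      have "card H \<noteq> 0" using fin H0 by auto
      then show ?thesis by (simp only: nonzero_divide_eq_eq times_divide_eq_left mult_1 of_nat_eq_0_iff divide_self not_False_eq_True)
    qed
    also have "single 0 1 * x = x" by (simp add: single_one)
    finally show ?thesis .
  qed
  then show ?thesis using fN by blast
qed

section \<open>Young symmetrizers\<close>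

text \<open>
  Composition is written additively, since \<^typ>\<open>'a \<Rightarrow>\<^sub>0 'b\<close> multiplies by convolution over an additive
  monoid. The group algebra is then the ring of finitely supported functions on this type.
\<close>

typedef fsym = "carrier (finitary_sym_group ({1..} :: nat set))"
  morphisms app Fsym
  using group.is_monoid[OF group_finitary_sym_group] monoid.one_closed by blast

lemma fsym_carrier_mult:
  assumes "p \<in> carrier (finitary_sym_group A)" "q \<in> carrier (finitary_sym_group A)"
  shows "p \<circ> q \<in> carrier (finitary_sym_group A)"
  using monoid.m_closed[OF group.is_monoid[OF group_finitary_sym_group] assms]
  by (simp add: finitary_sym_group_def)

instantiation fsym :: group_add
begin

definition zero_fsym :: fsym where "0 = Fsym id"
definition plus_fsym :: "fsym \<Rightarrow> fsym \<Rightarrow> fsym" where "g + h = Fsym (app g \<circ> app h)"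
definition uminus_fsym :: "fsym \<Rightarrow> fsym" where
  "- g = Fsym (m_inv (finitary_sym_group {1..}) (app g))"
definition minus_fsym :: "fsym \<Rightarrow> fsym \<Rightarrow> fsym" where "g - h = g + - (h :: fsym)"

instance
proof
  fix a b c :: fsym
  interpret S: group "finitary_sym_group ({1..} :: nat set)" by (rule group_finitary_sym_group)
  have 0: "app 0 = id" unfolding zero_fsym_def
    using S.one_closed by (subst Fsym_inverse) (simp_all add: finitary_sym_group_def)
  have add: "app (g + h) = app g \<circ> app h" for g h :: fsym
    unfolding plus_fsym_def by (intro Fsym_inverse fsym_carrier_mult app)
  show "a + b + c = a + (b + c)" "0 + a = a" "a + 0 = a"
    by (simp_all add: add 0 comp_assoc flip: app_inject)
  have "m_inv (finitary_sym_group {1..}) (app a) \<circ> app a = id"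
    using S.l_inv[OF app[of a]] by (simp add: finitary_sym_group_def)
  moreover have "app (- a) = m_inv (finitary_sym_group {1..}) (app a)"
    unfolding uminus_fsym_def by (rule Fsym_inverse[OF S.inv_closed[OF app]])
  ultimately show "- a + a = 0"
    by (simp only: app_inject[symmetric] add 0)
qed (simp add: minus_fsym_def)

end

lemma app_zero [simp]: "app 0 s = s"
  using monoid.one_closed[OF group.is_monoid[OF group_finitary_sym_group[of "{1..} :: nat set"]]]
  by (simp add: zero_fsym_def Fsym_inverse finitary_sym_group_def)

lemma app_add [simp]: "app (g + h) s = app g (app h s)"
  unfolding plus_fsym_def by (simp add: Fsym_inverse[OF fsym_carrier_mult[OF app app]])

lemma app_uminus_cancel [simp]: "app (- g) (app g s) = s" "app g (app (- g) s) = s"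
  by (simp_all flip: app_add)

lemma app_minus [simp]: "app (g - h) s = app g (app (- h) s)"
  by (simp flip: add_uminus_conv_diff)

lemma fsym_eqI: "(\<And>s. app g s = app h s) \<Longrightarrow> g = h"
  by (simp add: app_inject[symmetric] fun_eq_iff)

lemma app_eq_iff [simp]: "app g s = app g t \<longleftrightarrow> s = t"
  by (metis app_uminus_cancel(1))

lemma app_permutes: "app g permutes {1..}"
  using app[of g] by (simp add: finitary_sym_group_def)

lemma permutation_app: "permutation (app g)"
proof -
  have "app g permutes {x. app g x \<noteq> x}"
    using app_permutes[of g] by (auto simp: permutes_def)
  moreover have "finite {x. app g x \<noteq> x}"
    using app[of g] by (simp add: finitary_sym_group_def)
  ultimately show ?thesis unfolding permutation_permutes by blast
qed

lemma fsym_of_permutes: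
  assumes "q permutes X" "finite X" "X \<subseteq> {1..}"
  obtains g where "app g = q"
proof -
  have "{x. q x \<noteq> x} \<subseteq> X" using assms(1) by (auto simp: permutes_def)
  then have "finite {x. q x \<noteq> x}" using assms(2) finite_subset by blast
  moreover have "q permutes {1..}" using permutes_subset[OF assms(1,3)] .
  ultimately have "q \<in> carrier (finitary_sym_group {1..})" by (simp add: finitary_sym_group_def)
  then show thesis using that Fsym_inverse by blast
qed

definition psgn :: "fsym \<Rightarrow> 'k::ring_1" where
  "psgn g = of_int (sign (app g))"

lemma psgn_add: "psgn (g + h) = psgn g * psgn h"
proof -
  have "app (g + h) = app g \<circ> app h" by (simp add: fun_eq_iff)
  then show ?thesis by (simp add: psgn_def sign_compose permutation_app)
qed

lemma psgn_zero [simp]: "psgn 0 = 1"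
proof -
  have "app 0 = id" by (simp add: fun_eq_iff)
  then show ?thesis by (simp add: psgn_def)
qed

lemma psgn_conj: "(psgn (g + h - g) :: 'k::comm_ring_1) = psgn h"
proof -
  have "(psgn (g + h - g) :: 'k) = psgn (g + - g) * psgn h"
    unfolding add_uminus_conv_diff[symmetric] psgn_add by (simp only: mult_ac)
  then show ?thesis by simp
qed

section \<open>Symmetrizers weighted by a character\<close>

definition symmetrizer :: "('g \<Rightarrow> 'k) \<Rightarrow> 'g set \<Rightarrow> 'g \<Rightarrow>\<^sub>0 'k::comm_monoid_add" where
  "symmetrizer \<chi> H = (\<Sum>h\<in>H. single h (\<chi> h))"

lemma lookup_symmetrizer:
  "finite H \<Longrightarrow> lookup (symmetrizer \<chi> H) g = (if g \<in> H then \<chi> g else 0)"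
  by (auto simp: symmetrizer_def lookup_sum lookup_single when_def cong: if_cong)

lemma keys_symmetrizer: "finite H \<Longrightarrow> keys (symmetrizer \<chi> H) \<subseteq> H"
  by (auto simp: in_keys_iff lookup_symmetrizer split: if_splits)

lemma symmetrizer_absorb:
  fixes \<chi> :: "'g::group_add \<Rightarrow> 'k::comm_semiring_1"
  assumes H: "subgrp H" "h \<in> H" and \<chi>: "\<And>a b. \<chi> (a + b) = \<chi> a * \<chi> b"
  shows "single h (\<chi> h) * symmetrizer \<chi> H = symmetrizer \<chi> H"
    and "symmetrizer \<chi> H * single h (\<chi> h) = symmetrizer \<chi> H"
proof -
  show "single h (\<chi> h) * symmetrizer \<chi> H = symmetrizer \<chi> H"
    unfolding symmetrizer_def sum_distrib_left mult_single \<chi>[symmetric]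
    by (rule sum.reindex_bij_betw[OF subgrp_shift_left[OF H]])
  show "symmetrizer \<chi> H * single h (\<chi> h) = symmetrizer \<chi> H"
    unfolding symmetrizer_def sum_distrib_right mult_single \<chi>[symmetric]
    by (rule sum.reindex_bij_betw[OF subgrp_shift_right[OF H]])
qed

lemma symmetrizer_mult_subset:
  fixes \<chi> :: "'g::group_add \<Rightarrow> 'k::comm_semiring_1"
  assumes F: "subgrp F" "H \<subseteq> F" and \<chi>: "\<And>a b. \<chi> (a + b) = \<chi> a * \<chi> b"
  shows "symmetrizer \<chi> H * symmetrizer \<chi> F = of_nat (card H) * symmetrizer \<chi> F"
    and "symmetrizer \<chi> F * symmetrizer \<chi> H = of_nat (card H) * symmetrizer \<chi> F"
proof -
  have "symmetrizer \<chi> H * symmetrizer \<chi> F = (\<Sum>h\<in>H. symmetrizer \<chi> F)"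
    unfolding symmetrizer_def[of \<chi> H] sum_distrib_right
    using F by (intro sum.cong refl symmetrizer_absorb \<chi>) auto
  then show "symmetrizer \<chi> H * symmetrizer \<chi> F = of_nat (card H) * symmetrizer \<chi> F" by simp
  have "symmetrizer \<chi> F * symmetrizer \<chi> H = (\<Sum>h\<in>H. symmetrizer \<chi> F)"
    unfolding symmetrizer_def[of \<chi> H] sum_distrib_left
    using F by (intro sum.cong refl symmetrizer_absorb \<chi>) auto
  then show "symmetrizer \<chi> F * symmetrizer \<chi> H = of_nat (card H) * symmetrizer \<chi> F" by simp
qed

lemma symmetrizer_conj:
  fixes \<chi> :: "'g::group_add \<Rightarrow> 'k::comm_semiring_1"
  assumes \<chi>: "\<And>h. \<chi> (\<sigma> + h - \<sigma>) = \<chi> h"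
  shows "single \<sigma> 1 * symmetrizer \<chi> H = symmetrizer \<chi> ((\<lambda>h. \<sigma> + h - \<sigma>) ` H) * single \<sigma> 1"
proof -
  have inj: "inj_on (\<lambda>h. \<sigma> + h - \<sigma>) H"
  proof (rule inj_onI)
    fix x y assume "\<sigma> + x - \<sigma> = \<sigma> + y - \<sigma>"
    then have "\<sigma> + x - \<sigma> + \<sigma> = \<sigma> + y - \<sigma> + \<sigma>" by (rule arg_cong)
    then show "x = y" by simp
  qed
  show ?thesis
    unfolding symmetrizer_def sum_distrib_left sum_distrib_right mult_single sum.reindex[OF inj]
    by (simp add: \<chi> mult_single)
qed

section \<open>Row and column groups as stabilizers of colourings\<close>

definition Sym :: "nat set \<Rightarrow> fsym set" where
  "Sym X = {g. \<forall>s. s \<notin> X \<longrightarrow> app g s = s}"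

text \<open>Colouring points by their row or by their column gives the row group or the column
  group. Conjugation then only transports the colouring, and row colourings can be varied without
  reference to a diagram.\<close>

definition colour_group :: "nat set \<Rightarrow> (nat \<Rightarrow> nat) \<Rightarrow> fsym set" where
  "colour_group X \<rho> = {g \<in> Sym X. \<forall>s\<in>X. \<rho> (app g s) = \<rho> s}"

lemma Sym_uminus:
  assumes "g \<in> Sym X"
  shows "- g \<in> Sym X"
proof -
  have "app (- g) s = s" if "s \<notin> X" for s
    using assms that app_uminus_cancel(1)[of g s] by (simp add: Sym_def)
  then show ?thesis by (simp add: Sym_def)
qed

lemma Sym_app_permutes:
  assumes "g \<in> Sym X"
  shows "app g permutes X"
  unfolding permutes_def
proof (intro conjI allI impI)
  show "app g s = s" if "s \<notin> X" for s using assms that by (simp add: Sym_def)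
  show "\<exists>!s. app g s = t" for t by (rule ex1I[of _ "app (- g) t"]) auto
qed

lemma Sym_app_in: "g \<in> Sym X \<Longrightarrow> app g s \<in> X \<longleftrightarrow> s \<in> X"
  by (rule permutes_in_image[OF Sym_app_permutes])

lemma Sym_app_uminus_in: "g \<in> Sym X \<Longrightarrow> app (- g) s \<in> X \<longleftrightarrow> s \<in> X"
  by (rule Sym_app_in[OF Sym_uminus])

lemma subgrp_Sym:
  assumes "finite X"
  shows "subgrp (Sym X)"
proof -
  have "app ` Sym X \<subseteq> {p. p permutes X}" using Sym_app_permutes by auto
  then have "finite (app ` Sym X)" using finite_permutations[OF assms] finite_subset by blast
  then have "finite (Sym X)" by (rule finite_imageD) (auto intro: inj_onI simp: app_inject)
  then show ?thesis
    unfolding subgrp_def using Sym_uminus by (auto simp: Sym_def)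
qed

lemma colour_group_uminus:
  assumes "g \<in> colour_group X \<rho>"
  shows "- g \<in> colour_group X \<rho>"
proof -
  have g: "g \<in> Sym X" using assms by (simp add: colour_group_def)
  have "\<rho> (app (- g) s) = \<rho> s" if "s \<in> X" for s
  proof -
    have "\<rho> (app g (app (- g) s)) = \<rho> (app (- g) s)"
      using assms that Sym_app_uminus_in[OF g, of s] unfolding colour_group_def by blast
    then show ?thesis by simp
  qed
  then show ?thesis using Sym_uminus[OF g] by (simp add: colour_group_def)
qed

lemma subgrp_colour_group:
  assumes "finite X"
  shows "subgrp (colour_group X \<rho>)"
proof -
  have S: "subgrp (Sym X)" by (rule subgrp_Sym[OF assms])
  then have "finite (colour_group X \<rho>)" by (simp add: subgrp_def colour_group_def)
  moreover have "a + b \<in> colour_group X \<rho>"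
    if a: "a \<in> colour_group X \<rho>" and b: "b \<in> colour_group X \<rho>" for a b
    using a b S Sym_app_in[of b X] by (simp add: subgrp_def colour_group_def)
  ultimately show ?thesis
    using S colour_group_uminus by (auto simp: subgrp_def colour_group_def)
qed

lemma colour_group_conj:
  "(\<lambda>h. \<sigma> + h - \<sigma>) ` colour_group X \<rho> = colour_group (app \<sigma> ` X) (\<lambda>s. \<rho> (app (- \<sigma>) s))"
proof -
  have sub: "\<sigma> + h - \<sigma> \<in> colour_group (app \<sigma> ` X) (\<lambda>s. \<rho> (app (- \<sigma>) s))"
    if "h \<in> colour_group X \<rho>" for \<sigma> h X and \<rho> :: "nat \<Rightarrow> nat"
  proof -
    have "app (\<sigma> + h - \<sigma>) s = s" if "s \<notin> app \<sigma> ` X" for s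
    proof -
      have "app (- \<sigma>) s \<notin> X" using that by (metis app_uminus_cancel(2) imageI)
      then show ?thesis using \<open>h \<in> _\<close> by (simp add: colour_group_def Sym_def)
    qed
    then show ?thesis using that by (auto simp: colour_group_def Sym_def)
  qed
  show ?thesis
  proof
    show "(\<lambda>h. \<sigma> + h - \<sigma>) ` colour_group X \<rho> \<subseteq> colour_group (app \<sigma> ` X) (\<lambda>s. \<rho> (app (- \<sigma>) s))"
      using sub by blast
    show "colour_group (app \<sigma> ` X) (\<lambda>s. \<rho> (app (- \<sigma>) s)) \<subseteq> (\<lambda>h. \<sigma> + h - \<sigma>) ` colour_group X \<rho>"
    proof
      fix g assume "g \<in> colour_group (app \<sigma> ` X) (\<lambda>s. \<rho> (app (- \<sigma>) s))"
      from sub[OF this, of "- \<sigma>"] have "- \<sigma> + g + \<sigma> \<in> colour_group X \<rho>"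
        by (simp add: image_image)
      moreover have "\<sigma> + (- \<sigma> + g + \<sigma>) - \<sigma> = g" by (rule fsym_eqI) simp
      ultimately show "g \<in> (\<lambda>h. \<sigma> + h - \<sigma>) ` colour_group X \<rho>" by (metis imageI)
    qed
  qed
qed

definition row_sym :: "nat set \<Rightarrow> (nat \<Rightarrow> nat) \<Rightarrow> fsym \<Rightarrow>\<^sub>0 'k::field_char_0" where
  "row_sym X \<rho> = symmetrizer (\<lambda>_. 1) (colour_group X \<rho>)"

definition col_sym :: "nat set \<Rightarrow> (nat \<Rightarrow> nat) \<Rightarrow> fsym \<Rightarrow>\<^sub>0 'k::field_char_0" where
  "col_sym X \<kappa> = symmetrizer psgn (colour_group X \<kappa>)"

definition young_sym :: "nat set \<Rightarrow> (nat \<Rightarrow> nat) \<Rightarrow> (nat \<Rightarrow> nat) \<Rightarrow> fsym \<Rightarrow>\<^sub>0 'k::field_char_0" where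
  "young_sym X \<rho> \<kappa> = col_sym X \<kappa> * row_sym X \<rho>"

lemma row_sym_absorb:
  assumes "finite X" "r \<in> colour_group X \<rho>"
  shows "single r 1 * row_sym X \<rho> = row_sym X \<rho>" "row_sym X \<rho> * single r 1 = row_sym X \<rho>"
  unfolding row_sym_def
  using symmetrizer_absorb[OF subgrp_colour_group[OF assms(1)] assms(2), of "\<lambda>_. 1"] by auto

lemma psgn_square: "(psgn g :: 'k::comm_ring_1) * psgn g = 1"
  by (simp add: psgn_def sign_idempotent flip: of_int_mult)

lemma col_sym_absorb:
  assumes "finite X" "c \<in> colour_group X \<kappa>"
  shows "(col_sym X \<kappa> :: fsym \<Rightarrow>\<^sub>0 'k::field_char_0) * single c 1 = single 0 (psgn c) * col_sym X \<kappa>"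
proof -
  have "(col_sym X \<kappa> :: fsym \<Rightarrow>\<^sub>0 'k) * single c (psgn c) = col_sym X \<kappa>"
    unfolding col_sym_def
    by (rule symmetrizer_absorb[OF subgrp_colour_group[OF assms(1)] assms(2) psgn_add])
  then have "single 0 (psgn c) * col_sym X \<kappa> = (col_sym X \<kappa> :: fsym \<Rightarrow>\<^sub>0 'k) * single c (psgn c) * single 0 (psgn c)"
    by (simp add: scalar_commute)
  also have "\<dots> = col_sym X \<kappa> * single c 1"
    by (simp add: mult.assoc mult_single psgn_square)
  finally show ?thesis ..
qed

lemma row_sym_conj:
  "single \<sigma> 1 * row_sym X \<rho> = row_sym (app \<sigma> ` X) (\<lambda>s. \<rho> (app (- \<sigma>) s)) * single \<sigma> 1"
  unfolding row_sym_def using symmetrizer_conj[of "\<lambda>_. 1" \<sigma> "colour_group X \<rho>"]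
  by (simp add: colour_group_conj)

lemma col_sym_conj:
  "single \<sigma> 1 * col_sym X \<kappa> = col_sym (app \<sigma> ` X) (\<lambda>s. \<kappa> (app (- \<sigma>) s)) * single \<sigma> 1"
  unfolding col_sym_def using symmetrizer_conj[of psgn \<sigma> "colour_group X \<kappa>", OF psgn_conj]
  by (simp add: colour_group_conj)

text \<open>The transposition of \<open>u\<close> and \<open>v\<close> lies in both groups. The row
  symmetrizer absorbs it with sign 1, the column antisymmetrizer with sign -1, so the product equals
  its own negative.\<close>

lemma col_row_sym_eq_0:
  assumes X: "finite X" "X \<subseteq> {1..}" and uv: "u \<in> X" "v \<in> X" "u \<noteq> v" "\<kappa> u = \<kappa> v" "\<rho> u = \<rho> v"
  shows "(col_sym X \<kappa> :: fsym \<Rightarrow>\<^sub>0 'k::field_char_0) * row_sym X \<rho> = 0"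
proof -
  let ?b = "col_sym X \<kappa> :: fsym \<Rightarrow>\<^sub>0 'k" and ?a = "row_sym X \<rho> :: fsym \<Rightarrow>\<^sub>0 'k"
  have "transpose u v permutes X" using uv by (simp add: permutes_swap_id)
  then obtain t where t: "app t = transpose u v" using fsym_of_permutes X by blast
  have S: "t \<in> Sym X" using uv by (auto simp: Sym_def t transpose_def)
  have mem: "t \<in> colour_group X \<kappa>" "t \<in> colour_group X \<rho>"
    using uv S by (auto simp: colour_group_def t transpose_def)
  have sgn_t: "(psgn t :: 'k) = -1" using uv by (simp add: psgn_def t sign_swap_id)
  have "?b * ?a = ?b * (single t 1 * ?a)" by (simp add: row_sym_absorb[OF X(1) mem(2)])
  also have "\<dots> = single 0 (- 1) * (?b * ?a)"
    using col_sym_absorb[OF X(1) mem(1), where 'k = 'k] by (simp add: sgn_t flip: mult.assoc)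
  finally have eq: "?b * ?a = single 0 (- 1) * (?b * ?a)" .
  show ?thesis
  proof (rule poly_mapping_eqI)
    fix g
    have "lookup (?b * ?a) g = - lookup (?b * ?a) g"
      by (subst eq) (simp only: lookup_single_times, simp)
    then have "2 * lookup (?b * ?a) g = 0" by (simp only: mult_2) (metis add.right_inverse)
    then show "lookup (?b * ?a) g = lookup 0 g" by simp
  qed
qed

section \<open>Tableaux\<close>

text \<open>Entries may stand in any order; an increasing filling enters only through
  \<open>tableau_of_lattice_word\<close>.\<close>

definition tableau :: "nat set \<Rightarrow> (nat \<Rightarrow> nat) \<Rightarrow> (nat \<Rightarrow> nat) \<Rightarrow> bool" where
  "tableau X \<rho> \<kappa> \<longleftrightarrow> inj_on (\<lambda>s. (\<rho> s, \<kappa> s)) X \<and> young ((\<lambda>s. (\<rho> s, \<kappa> s)) ` X)"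

lemma young_downD: "young D \<Longrightarrow> (i, j) \<in> D \<Longrightarrow> i' \<le> i \<Longrightarrow> j' \<le> j \<Longrightarrow> (i', j') \<in> D"
  by (auto simp: young_def downset_def)

lemma down_closed_eq_lessThan:
  fixes A :: "nat set"
  assumes "finite A" "\<And>x y. x \<in> A \<Longrightarrow> y \<le> x \<Longrightarrow> y \<in> A"
  shows "A = {..<card A}"
proof (cases "A = {}")
  case False
  have "A = {..Max A}"
  proof
    show "A \<subseteq> {..Max A}" using assms(1) by auto
    show "{..Max A} \<subseteq> A" using assms(2)[OF Max_in[OF assms(1) False]] by auto
  qed
  moreover from this have "card A = Suc (Max A)" by (metis card_atMost)
  ultimately show ?thesis by (simp add: lessThan_Suc_atMost)
qed simp

lemma tableau_column:
  assumes "finite X" "tableau X \<rho> \<kappa>"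
  shows "inj_on \<rho> {s \<in> X. \<kappa> s = j}"
    and "\<rho> ` {s \<in> X. \<kappa> s = j} = {..<card {s \<in> X. \<kappa> s = j}}"
proof -
  show inj: "inj_on \<rho> {s \<in> X. \<kappa> s = j}"
    using assms(2) by (auto simp: tableau_def inj_on_def)
  have "i' \<in> \<rho> ` {s \<in> X. \<kappa> s = j}" if "i \<in> \<rho> ` {s \<in> X. \<kappa> s = j}" "i' \<le> i" for i i'
  proof -
    have "(i, j) \<in> (\<lambda>s. (\<rho> s, \<kappa> s)) ` X" using that(1) by auto
    then have "(i', j) \<in> (\<lambda>s. (\<rho> s, \<kappa> s)) ` X"
      using assms(2) that(2) young_downD unfolding tableau_def by blast
    then show ?thesis by auto
  qed
  then have "\<rho> ` {s \<in> X. \<kappa> s = j} = {..<card (\<rho> ` {s \<in> X. \<kappa> s = j})}"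
    using assms(1) by (intro down_closed_eq_lessThan) auto
  then show "\<rho> ` {s \<in> X. \<kappa> s = j} = {..<card {s \<in> X. \<kappa> s = j}}"
    by (simp add: card_image[OF inj])
qed

lemma card_tableau_column_less:
  assumes "finite X" "tableau X \<rho> \<kappa>"
  shows "card {s \<in> X. \<kappa> s = j \<and> \<rho> s < m} = min (card {s \<in> X. \<kappa> s = j}) m"
proof -
  let ?C = "{s \<in> X. \<kappa> s = j}"
  have "inj_on \<rho> {s \<in> X. \<kappa> s = j \<and> \<rho> s < m}"
    by (rule inj_on_subset[OF tableau_column(1)[OF assms, of j]]) auto
  then have "card {s \<in> X. \<kappa> s = j \<and> \<rho> s < m} = card (\<rho> ` {s \<in> X. \<kappa> s = j \<and> \<rho> s < m})"
    by (simp add: card_image)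
  also have "\<rho> ` {s \<in> X. \<kappa> s = j \<and> \<rho> s < m} = \<rho> ` ?C \<inter> {..<m}" by auto
  also have "\<dots> = {..<min (card ?C) m}" unfolding tableau_column(2)[OF assms] by auto
  finally show ?thesis by simp
qed

text \<open>With distinct rows in a column of height \<open>h\<close>, at most
  \<open>min h m\<close> points can have row less than \<open>m\<close>; a tableau attains this
  bound.\<close>

lemma column_card_le:
  assumes "finite X" "tableau X \<rho> \<kappa>" and inj: "inj_on (\<lambda>s. (\<rho>' s, \<kappa> s)) X"
  shows "card {s \<in> X. \<kappa> s = j \<and> \<rho>' s < m} \<le> card {s \<in> X. \<kappa> s = j \<and> \<rho> s < m}"
proof -
  have "inj_on \<rho>' {s \<in> X. \<kappa> s = j \<and> \<rho>' s < m}"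
    using inj by (auto simp: inj_on_def)
  moreover have "\<rho>' ` {s \<in> X. \<kappa> s = j \<and> \<rho>' s < m} \<subseteq> {..<m}" by auto
  ultimately have "card {s \<in> X. \<kappa> s = j \<and> \<rho>' s < m} \<le> m"
    using card_inj_on_le[of \<rho>' _ "{..<m}"] by simp
  moreover have "card {s \<in> X. \<kappa> s = j \<and> \<rho>' s < m} \<le> card {s \<in> X. \<kappa> s = j}"
    using assms(1) by (intro card_mono) auto
  ultimately show ?thesis by (simp add: card_tableau_column_less[OF assms(1,2)])
qed

lemma card_sum_columns:
  assumes "finite X"
  shows "card {s \<in> X. P s} = (\<Sum>j\<in>\<kappa> ` X. card {s \<in> X. \<kappa> s = j \<and> P s})"
proof -
  have "(\<Sum>j\<in>\<kappa> ` X. sum (\<lambda>_. 1) {s \<in> {s \<in> X. P s}. \<kappa> s = j}) = sum (\<lambda>_. 1 :: nat) {s \<in> X. P s}"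
    using assms by (intro sum.group) auto
  moreover have "{s \<in> {s \<in> X. P s}. \<kappa> s = j} = {s \<in> X. \<kappa> s = j \<and> P s}" for j by auto
  ultimately show ?thesis by simp
qed

text \<open>The dominance order, obtained by summing \<open>column_card_le\<close> over all
  columns.\<close>

lemma tableau_dominates:
  assumes "finite X" "tableau X \<rho> \<kappa>" "inj_on (\<lambda>s. (\<rho>' s, \<kappa> s)) X"
  shows "card {s \<in> X. \<rho>' s < m} \<le> card {s \<in> X. \<rho> s < m}"
  unfolding card_sum_columns[OF assms(1), of "\<lambda>s. \<rho>' s < m" \<kappa>]
    card_sum_columns[OF assms(1), of "\<lambda>s. \<rho> s < m" \<kappa>]
  by (intro sum_mono column_card_le assms)

text \<open>The equality case of \<open>tableau_dominates\<close>: equal totals force equality in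
  each column. With \<open>m\<close> the height of the column of \<open>s\<close>, this shows that
  \<open>\<rho>' s\<close> is the row of a cell in that column, and \<open>q\<close> moves
  \<open>s\<close> to the point in that cell.\<close>

lemma tableau_rearrange:
  assumes X: "finite X" and T: "tableau X \<rho> \<kappa>" and inj: "inj_on (\<lambda>s. (\<rho>' s, \<kappa> s)) X"
    and cards: "\<And>m. card {s \<in> X. \<rho>' s < m} = card {s \<in> X. \<rho> s < m}"
  obtains q where "q permutes X" "\<And>s. s \<in> X \<Longrightarrow> \<kappa> (q s) = \<kappa> s" "\<And>s. s \<in> X \<Longrightarrow> \<rho> (q s) = \<rho>' s"
proof -
  have ex: "\<exists>t\<in>X. \<kappa> t = \<kappa> s \<and> \<rho> t = \<rho>' s" if s: "s \<in> X" for s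
  proof -
    let ?C = "{t \<in> X. \<kappa> t = \<kappa> s}" and ?h = "card {t \<in> X. \<kappa> t = \<kappa> s}"
    have "card {t \<in> X. \<kappa> t = \<kappa> s \<and> \<rho>' t < ?h} = card {t \<in> X. \<kappa> t = \<kappa> s \<and> \<rho> t < ?h}"
    proof (rule sum_mono_inv[where I = "\<kappa> ` X" and i = "\<kappa> s" and
          f = "\<lambda>j. card {t \<in> X. \<kappa> t = j \<and> \<rho>' t < ?h}" and
          g = "\<lambda>j. card {t \<in> X. \<kappa> t = j \<and> \<rho> t < ?h}"])
      show "(\<Sum>j\<in>\<kappa> ` X. card {t \<in> X. \<kappa> t = j \<and> \<rho>' t < ?h}) = (\<Sum>j\<in>\<kappa> ` X. card {t \<in> X. \<kappa> t = j \<and> \<rho> t < ?h})"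
        using cards[of ?h] card_sum_columns[OF X, of "\<lambda>t. \<rho>' t < ?h" \<kappa>]
          card_sum_columns[OF X, of "\<lambda>t. \<rho> t < ?h" \<kappa>] by simp
    qed (use X T inj s in \<open>auto intro: column_card_le\<close>)
    also have "\<dots> = card ?C" by (simp add: card_tableau_column_less[OF X T])
    finally have "{t \<in> X. \<kappa> t = \<kappa> s \<and> \<rho>' t < ?h} = ?C"
      using X by (intro card_subset_eq) auto
    then have "\<rho>' s \<in> {..<?h}" using s by blast
    then have "\<rho>' s \<in> \<rho> ` ?C" unfolding tableau_column(2)[OF X T] .
    then show ?thesis by auto
  qed
  define q where "q s = (if s \<in> X then SOME t. t \<in> X \<and> \<kappa> t = \<kappa> s \<and> \<rho> t = \<rho>' s else s)" for s
  have q: "q s \<in> X \<and> \<kappa> (q s) = \<kappa> s \<and> \<rho> (q s) = \<rho>' s" if "s \<in> X" for s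
    unfolding q_def using that ex[OF that] someI_ex[of "\<lambda>t. t \<in> X \<and> \<kappa> t = \<kappa> s \<and> \<rho> t = \<rho>' s"] by auto
  have injq: "inj_on q X"
  proof (rule inj_onI)
    fix s t assume st: "s \<in> X" "t \<in> X" "q s = q t"
    then have "(\<rho>' s, \<kappa> s) = (\<rho>' t, \<kappa> t)" using q[of s] q[of t] by simp
    then show "s = t" using inj_onD[OF inj] st by blast
  qed
  have "bij_betw q X X"
    unfolding bij_betw_def using injq endo_inj_surj[OF X _ injq] q by auto
  then have "q permutes X"
    by (rule bij_imp_permutes) (simp add: q_def)
  then show thesis using that q by blast
qed

lemma card_Sym_image:
  assumes "\<sigma> \<in> Sym X"
  shows "card {s \<in> X. P (app (- \<sigma>) s)} = card {s \<in> X. P s}"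
proof -
  have "bij_betw (app \<sigma>) {s \<in> X. P s} {s \<in> X. P (app (- \<sigma>) s)}"
    by (rule bij_betwI[where g = "app (- \<sigma>)"]) (use Sym_app_in[OF assms] Sym_app_uminus_in[OF assms] in auto)
  then show ?thesis by (simp add: bij_betw_same_card)
qed

lemma Sym_image_eq: "\<sigma> \<in> Sym X \<Longrightarrow> app \<sigma> ` X = X"
  by (rule permutes_image[OF Sym_app_permutes])

lemma row_sym_conj_Sym:
  assumes "\<sigma> \<in> Sym X"
  shows "single \<sigma> 1 * row_sym X \<rho> = row_sym X (\<lambda>s. \<rho> (app (- \<sigma>) s)) * single \<sigma> 1"
  using row_sym_conj[of \<sigma> X \<rho>] by (simp add: Sym_image_eq[OF assms])

lemma col_row_sym_nonzero_imp_inj: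
  assumes "finite X" "X \<subseteq> {1..}" "(col_sym X \<kappa> :: fsym \<Rightarrow>\<^sub>0 'k::field_char_0) * row_sym X \<rho> \<noteq> 0"
  shows "inj_on (\<lambda>s. (\<rho> s, \<kappa> s)) X"
  using assms(3) col_row_sym_eq_0[OF assms(1,2), of _ _ \<kappa> \<rho>, where 'k = 'k]
  by (auto simp: inj_on_def)

text \<open>Von Neumann's lemma. Either two points share a column of the tableau and a row of its
  image under \<open>\<sigma>\<close>, and the product vanishes, or \<open>\<sigma>\<close> is the
  product of a column permutation and a row permutation, and both are absorbed up to sign.\<close>

lemma col_single_row_sym:
  assumes X: "finite X" "X \<subseteq> {1..}" and T: "tableau X \<rho> \<kappa>" and \<sigma>: "\<sigma> \<in> Sym X"
  shows "\<exists>k. (col_sym X \<kappa> :: fsym \<Rightarrow>\<^sub>0 'k::field_char_0) * single \<sigma> 1 * row_sym X \<rho> =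
    single 0 k * young_sym X \<rho> \<kappa>"
proof -
  let ?b = "col_sym X \<kappa> :: fsym \<Rightarrow>\<^sub>0 'k" and ?a = "row_sym X \<rho> :: fsym \<Rightarrow>\<^sub>0 'k"
  define \<rho>' where "\<rho>' s = \<rho> (app (- \<sigma>) s)" for s
  have eq: "?b * single \<sigma> 1 * ?a = ?b * row_sym X \<rho>' * single \<sigma> 1"
    unfolding mult.assoc row_sym_conj_Sym[OF \<sigma>] by (simp add: \<rho>'_def[abs_def])
  show ?thesis
  proof (cases "?b * row_sym X \<rho>' = 0")
    case True
    then show ?thesis by (intro exI[of _ 0]) (simp add: eq)
  next
    case False
    then have inj: "inj_on (\<lambda>s. (\<rho>' s, \<kappa> s)) X" by (rule col_row_sym_nonzero_imp_inj[OF X])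
    have cards: "card {s \<in> X. \<rho>' s < m} = card {s \<in> X. \<rho> s < m}" for m
      unfolding \<rho>'_def using card_Sym_image[OF \<sigma>, of "\<lambda>s. \<rho> s < m"] .
    obtain q where q: "q permutes X" "\<And>s. s \<in> X \<Longrightarrow> \<kappa> (q s) = \<kappa> s" "\<And>s. s \<in> X \<Longrightarrow> \<rho> (q s) = \<rho>' s"
      using tableau_rearrange[OF X(1) T inj cards] by metis
    obtain \<theta> where \<theta>: "app \<theta> = q" using fsym_of_permutes[OF q(1) X] by blast
    have "\<theta> \<in> Sym X" using q(1) by (simp add: Sym_def \<theta> permutes_not_in)
    then have "\<theta> \<in> colour_group X \<kappa>" using q(2) by (simp add: colour_group_def \<theta>)
    then have m\<theta>: "- \<theta> \<in> colour_group X \<kappa>" by (rule colour_group_uminus)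
    have "\<theta> + \<sigma> \<in> Sym X"
      using \<open>\<theta> \<in> Sym X\<close> \<sigma> subgrp_Sym[OF X(1)] by (simp add: subgrp_def)
    moreover have "\<rho> (app (\<theta> + \<sigma>) s) = \<rho> s" if "s \<in> X" for s
      using q(3)[of "app \<sigma> s"] Sym_app_in[OF \<sigma>] that by (simp add: \<theta> \<rho>'_def)
    ultimately have r: "\<theta> + \<sigma> \<in> colour_group X \<rho>" by (simp add: colour_group_def)
    have "single \<sigma> (1 :: 'k) = single (- \<theta>) 1 * single (\<theta> + \<sigma>) 1"
      by (simp add: mult_single flip: add.assoc)
    then have "?b * single \<sigma> 1 * ?a = (?b * single (- \<theta>) 1) * (single (\<theta> + \<sigma>) 1 * ?a)"
      by (simp add: mult.assoc)
    also have "\<dots> = single 0 (psgn (- \<theta>)) * young_sym X \<rho> \<kappa>"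
      unfolding row_sym_absorb(1)[OF X(1) r] col_sym_absorb[OF X(1) m\<theta>] young_sym_def mult.assoc ..
    finally show ?thesis by blast
  qed
qed

lemma single_sum: "single g (\<Sum>i\<in>A. c i) = (\<Sum>i\<in>A. single g (c i))"
  by (induction A rule: infinite_finite_induct) (simp_all add: single_add)

lemma col_mult_row_sym:
  assumes X: "finite X" "X \<subseteq> {1..}" and T: "tableau X \<rho> \<kappa>" and y: "keys y \<subseteq> Sym X"
  shows "\<exists>k. (col_sym X \<kappa> :: fsym \<Rightarrow>\<^sub>0 'k::field_char_0) * y * row_sym X \<rho> =
    single 0 k * young_sym X \<rho> \<kappa>"
proof -
  let ?b = "col_sym X \<kappa> :: fsym \<Rightarrow>\<^sub>0 'k" and ?a = "row_sym X \<rho> :: fsym \<Rightarrow>\<^sub>0 'k"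
  obtain f where f: "\<And>\<sigma>. \<sigma> \<in> Sym X \<Longrightarrow> ?b * single \<sigma> 1 * ?a = single 0 (f \<sigma>) * young_sym X \<rho> \<kappa>"
    using col_single_row_sym[OF X T, where 'k = 'k] by metis
  have fin: "finite (Sym X)" using subgrp_Sym[OF X(1)] by (simp add: subgrp_def)
  have "?b * y * ?a = (\<Sum>\<sigma>\<in>Sym X. ?b * single \<sigma> (lookup y \<sigma>) * ?a)"
    by (subst poly_mapping_sum_single[OF fin y]) (simp add: sum_distrib_left sum_distrib_right)
  also have "\<dots> = (\<Sum>\<sigma>\<in>Sym X. single 0 (lookup y \<sigma> * f \<sigma>) * young_sym X \<rho> \<kappa>)"
  proof (intro sum.cong refl)
    fix \<sigma> assume \<sigma>: "\<sigma> \<in> Sym X"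
    have "single \<sigma> (lookup y \<sigma>) = single 0 (lookup y \<sigma>) * single \<sigma> 1" by (simp add: mult_single)
    then have "?b * single \<sigma> (lookup y \<sigma>) * ?a = (?b * single 0 (lookup y \<sigma>)) * single \<sigma> 1 * ?a"
      by (simp only: mult.assoc)
    also have "\<dots> = single 0 (lookup y \<sigma>) * (?b * single \<sigma> 1 * ?a)"
      by (simp only: scalar_commute[symmetric] mult.assoc)
    also have "\<dots> = single 0 (lookup y \<sigma> * f \<sigma>) * young_sym X \<rho> \<kappa>"
      unfolding f[OF \<sigma>] by (simp add: mult_single flip: mult.assoc)
    finally show "?b * single \<sigma> (lookup y \<sigma>) * ?a = single 0 (lookup y \<sigma> * f \<sigma>) * young_sym X \<rho> \<kappa>" .
  qed
  also have "\<dots> = single 0 (\<Sum>\<sigma>\<in>Sym X. lookup y \<sigma> * f \<sigma>) * young_sym X \<rho> \<kappa>"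
    by (simp add: single_sum sum_distrib_right)
  finally show ?thesis by blast
qed

section \<open>Lattice words\<close>

lemma sum_power_less:
  fixes u :: "nat \<Rightarrow> nat"
  assumes "0 < B" "A \<subseteq> {..<s}" "\<And>t. t \<in> A \<Longrightarrow> u t < B"
  shows "(\<Sum>t\<in>A. u t * B ^ t) < B ^ s"
proof -
  have geo: "(\<Sum>t<n. (B - 1) * B ^ t) + 1 = B ^ n" for n
  proof -
    obtain C where "B = Suc C" using assms(1) gr0_implies_Suc by blast
    then show ?thesis by (induction n) simp_all
  qed
  have "(\<Sum>t\<in>A. u t * B ^ t) \<le> (\<Sum>t\<in>A. (B - 1) * B ^ t)"
    using assms(1,3) by (intro sum_mono mult_right_mono) fastforce+
  also have "\<dots> \<le> (\<Sum>t<s. (B - 1) * B ^ t)"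
    using assms(2) by (intro sum_mono2) auto
  also have "\<dots> < B ^ s" using geo[of s] by linarith
  finally show ?thesis .
qed

text \<open>Larger positions carry more significant digits, so the last disagreement decides: all
  positions before it together contribute less than \<open>B ^ s\<close>.\<close>

lemma code_less:
  fixes u v :: "nat \<Rightarrow> nat"
  assumes "finite X" "s \<in> X" "u s < v s" and u: "\<And>t. t \<in> X \<Longrightarrow> u t < B"
    and eq: "\<And>t. t \<in> X \<Longrightarrow> s < t \<Longrightarrow> u t = v t"
  shows "(\<Sum>t\<in>X. u t * B ^ t) < (\<Sum>t\<in>X. v t * B ^ t)"
proof -
  let ?L = "{t \<in> X. t < s}" and ?H = "{t \<in> X. s < t}"
  have X: "X = ?L \<union> ({s} \<union> ?H)" using assms(2) by auto
  have split: "(\<Sum>t\<in>X. f t) = (\<Sum>t\<in>?L. f t) + (f s + (\<Sum>t\<in>?H. f t))" for f :: "nat \<Rightarrow> nat"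
  proof -
    have "(\<Sum>t\<in>X. f t) = (\<Sum>t\<in>?L \<union> ({s} \<union> ?H). f t)" using X by simp
    also have "\<dots> = (\<Sum>t\<in>?L. f t) + (\<Sum>t\<in>{s} \<union> ?H. f t)"
      using assms(1) by (intro sum.union_disjoint) auto
    also have "(\<Sum>t\<in>{s} \<union> ?H. f t) = f s + (\<Sum>t\<in>?H. f t)"
      using assms(1) by (subst sum.union_disjoint) auto
    finally show ?thesis .
  qed
  have "(\<Sum>t\<in>?L. u t * B ^ t) < B ^ s"
    using u u[OF assms(2)] by (intro sum_power_less) auto
  then have "(\<Sum>t\<in>X. u t * B ^ t) < B ^ s + (u s * B ^ s + (\<Sum>t\<in>?H. u t * B ^ t))"
    unfolding split[of "\<lambda>t. u t * B ^ t"] by linarith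
  also have "\<dots> = Suc (u s) * B ^ s + (\<Sum>t\<in>?H. u t * B ^ t)" by simp
  also have "\<dots> \<le> v s * B ^ s + (\<Sum>t\<in>?H. u t * B ^ t)"
    using assms(3) by (intro add_right_mono mult_right_mono) auto
  also have "(\<Sum>t\<in>?H. u t * B ^ t) = (\<Sum>t\<in>?H. v t * B ^ t)"
    using eq by (intro sum.cong refl) auto
  also have "v s * B ^ s + (\<Sum>t\<in>?H. v t * B ^ t) \<le> (\<Sum>t\<in>X. v t * B ^ t)"
    unfolding split[of "\<lambda>t. v t * B ^ t"] by linarith
  finally show ?thesis .
qed

lemma last_disagreement:
  fixes X :: "nat set"
  assumes "finite X" "x \<in> X" "u x \<noteq> v x"
  obtains s where "s \<in> X" "u s \<noteq> v s" "\<And>t. t \<in> X \<Longrightarrow> s < t \<Longrightarrow> u t = v t"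
proof -
  let ?D = "{s \<in> X. u s \<noteq> v s}"
  have D: "finite ?D" "?D \<noteq> {}" using assms by auto
  then have "Max ?D \<in> ?D" by (rule Max_in)
  moreover have "u t = v t" if "t \<in> X" "Max ?D < t" for t
  proof (rule ccontr)
    assume "u t \<noteq> v t"
    then have "t \<le> Max ?D" using D that by (intro Max_ge) auto
    then show False using that by simp
  qed
  ultimately show thesis using that by blast
qed

lemma code_inj:
  fixes u v :: "nat \<Rightarrow> nat"
  assumes "finite X" "\<And>t. t \<in> X \<Longrightarrow> u t < B" "\<And>t. t \<in> X \<Longrightarrow> v t < B"
    and "(\<Sum>t\<in>X. u t * B ^ t) = (\<Sum>t\<in>X. v t * B ^ t)" "t \<in> X"
  shows "u t = v t"
proof (rule ccontr)
  assume "u t \<noteq> v t"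
  then obtain s where s: "s \<in> X" "u s \<noteq> v s" "\<And>t. t \<in> X \<Longrightarrow> s < t \<Longrightarrow> u t = v t"
    using last_disagreement[OF assms(1,5), of u v] by metis
  show False
  proof (cases "u s < v s")
    case True
    show False using code_less[of X s u v B] assms s True by simp
  next
    case False
    then show False using code_less[of X s v u B] assms s by simp
  qed
qed

text \<open>Yamanouchi or ballot words; the positions are the points of \<open>X\<close> in
  increasing order.\<close>

definition lattice_word :: "nat set \<Rightarrow> (nat \<Rightarrow> nat) \<Rightarrow> bool" where
  "lattice_word X w \<longleftrightarrow>
    (\<forall>i m. card {s \<in> X. s \<le> m \<and> w s = Suc i} \<le> card {s \<in> X. s \<le> m \<and> w s = i})"

text \<open>The rank of a letter among its equals, counted from 0. It is the column that receives
  \<open>s\<close> when letters are read as rows and each row is filled from left to right.\<close>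

definition occurrence :: "nat set \<Rightarrow> (nat \<Rightarrow> nat) \<Rightarrow> nat \<Rightarrow> nat" where
  "occurrence X w s = card {t \<in> X. t < s \<and> w t = w s}"

lemma ex_element_with_rank:
  fixes P :: "nat set"
  assumes "finite P" "j < card P"
  shows "\<exists>t\<in>P. card {u \<in> P. u < t} = j"
  using assms
proof (induction P rule: finite_linorder_max_induct)
  case (insert b A)
  show ?case
  proof (cases "j < card A")
    case True
    then obtain t where t: "t \<in> A" "card {u \<in> A. u < t} = j" using insert by blast
    then have "{u \<in> insert b A. u < t} = {u \<in> A. u < t}" using insert(2) by fastforce
    then show ?thesis using t by (intro bexI[of _ t]) simp_all
  next
    case False
    have "b \<notin> A" using insert(2) by blast
    then have "j = card A" using False insert(1,4) by simp
    moreover have "{u \<in> insert b A. u < b} = A" using insert(2) by auto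
    ultimately show ?thesis by (intro bexI[of _ b]) simp_all
  qed
qed simp

lemma occurrence_inj:
  assumes "finite X" "s \<in> X" "t \<in> X" "w s = w t" "occurrence X w s = occurrence X w t"
  shows "s = t"
proof -
  have less: "occurrence X w s < occurrence X w t" if st: "s \<in> X" "w s = w t" "s < t" for s t
    unfolding occurrence_def
  proof (rule psubset_card_mono)
    have "s \<notin> {u \<in> X. u < s \<and> w u = w s}" "s \<in> {u \<in> X. u < t \<and> w u = w t}"
      using st by simp_all
    moreover have "{u \<in> X. u < s \<and> w u = w s} \<subseteq> {u \<in> X. u < t \<and> w u = w t}"
      using st by auto
    ultimately show "{u \<in> X. u < s \<and> w u = w s} \<subset> {u \<in> X. u < t \<and> w u = w t}" by blast
  qed (use assms(1) in simp)
  show ?thesis using less[of s t] less[of t s] assms by (cases s t rule: linorder_cases) auto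
qed

text \<open>Up to and including \<open>s\<close> the letter \<open>i + 1\<close> occurs
  \<open>Suc (occurrence X w s)\<close> times. The lattice condition provides at least as many
  letters \<open>i\<close>, hence one of the same rank.\<close>

lemma occurrence_above:
  assumes X: "finite X" and w: "lattice_word X w" and s: "s \<in> X" "w s = Suc i"
  shows "\<exists>t\<in>X. t < s \<and> w t = i \<and> occurrence X w t = occurrence X w s"
proof -
  let ?P = "{t \<in> X. t \<le> s \<and> w t = i}"
  have "{t \<in> X. t \<le> s \<and> w t = Suc i} = insert s {t \<in> X. t < s \<and> w t = w s}"
    using s by auto
  then have "card {t \<in> X. t \<le> s \<and> w t = Suc i} = Suc (occurrence X w s)"
    using X by (simp add: occurrence_def)
  then have "occurrence X w s < card ?P"
    using w[unfolded lattice_word_def, rule_format, of s i] by (simp add: Suc_le_eq)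
  then obtain t where t: "t \<in> ?P" "card {u \<in> ?P. u < t} = occurrence X w s"
    using ex_element_with_rank[of ?P] X by auto
  then have "{u \<in> ?P. u < t} = {u \<in> X. u < t \<and> w u = w t}" by auto
  then have "occurrence X w t = occurrence X w s" using t(2) by (simp add: occurrence_def)
  moreover have "t \<noteq> s" using t(1) s by auto
  ultimately show ?thesis using t(1) by (intro bexI[of _ t]) simp_all
qed

lemma occurrence_left:
  assumes X: "finite X" and "j < occurrence X w s"
  shows "\<exists>t\<in>X. w t = w s \<and> occurrence X w t = j"
proof -
  let ?P = "{t \<in> X. t < s \<and> w t = w s}"
  obtain t where t: "t \<in> ?P" "card {u \<in> ?P. u < t} = j"
    using ex_element_with_rank[of ?P j] assms by (auto simp: occurrence_def)
  then have "{u \<in> ?P. u < t} = {u \<in> X. u < t \<and> w u = w t}" by auto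
  then have "occurrence X w t = j" using t(2) by (simp add: occurrence_def)
  then show ?thesis using t(1) by (intro bexI[of _ t]) simp_all
qed

lemma occurrence_above_less:
  assumes X: "finite X" and w: "lattice_word X w" and "s \<in> X" "i < w s"
  shows "\<exists>t\<in>X. t < s \<and> w t = i \<and> occurrence X w t = occurrence X w s"
  using assms(3,4)
proof (induction "w s" arbitrary: s)
  case (Suc k)
  obtain t where t: "t \<in> X" "t < s" "w t = k" "occurrence X w t = occurrence X w s"
    using occurrence_above[OF X w Suc.prems(1)] Suc.hyps(2) by metis
  show ?case
  proof (cases "i = k")
    case False
    then have "i < w t" using Suc.prems(2) Suc.hyps(2) t(3) by simp
    then obtain u where "u \<in> X" "u < t" "w u = i" "occurrence X w u = occurrence X w t"
      using Suc.hyps(1)[of t] t by blast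
    then show ?thesis using t by (intro bexI[of _ u]) auto
  qed (use t in blast)
qed simp

text \<open>The classical passage from ballot words to standard tableaux:
  \<open>occurrence_above_less\<close> fills the cells above, \<open>occurrence_left\<close> those
  to the left.\<close>

lemma lattice_word_young:
  assumes X: "finite X" and w: "lattice_word X w"
  shows "young ((\<lambda>s. (w s, occurrence X w s)) ` X)"
  unfolding young_def downset_def
proof (intro conjI ballI impI)
  fix p q assume p: "p \<in> (\<lambda>s. (w s, occurrence X w s)) ` X" and qp: "le_box q p"
  obtain i j where q: "q = (i, j)" by fastforce
  from p obtain s where "s \<in> X" "p = (w s, occurrence X w s)" by (rule imageE)
  then have s: "s \<in> X" "i \<le> w s" "j \<le> occurrence X w s" using qp q by simp_all
  have "\<exists>t\<in>X. w t = i \<and> occurrence X w t = occurrence X w s"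
    using occurrence_above_less[OF X w s(1), of i] s by (cases "i = w s") auto
  then obtain t where t: "t \<in> X" "w t = i" "occurrence X w t = occurrence X w s" by blast
  have "\<exists>u\<in>X. w u = i \<and> occurrence X w u = j"
    using occurrence_left[OF X, of j w t] s(3) t by (cases "j = occurrence X w t") auto
  then obtain u where "u \<in> X" "w u = i" "occurrence X w u = j" by blast
  then show "q \<in> (\<lambda>s. (w s, occurrence X w s)) ` X" unfolding q by (intro image_eqI[of _ _ u]) simp_all
qed simp

lemma lattice_word_column:
  assumes X: "finite X" and w: "lattice_word X w" and st: "s \<in> X" "t \<in> X"
    "occurrence X w s = occurrence X w t" "w s < w t"
  shows "s < t"
proof -
  obtain u where u: "u \<in> X" "u < t" "w u = w s" "occurrence X w u = occurrence X w t"
    using occurrence_above_less[OF X w st(2,4)] by blast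
  then have "u = s" using occurrence_inj[OF X u(1) st(1)] st(3) by simp
  then show ?thesis using u(2) by simp
qed

text \<open>The letter at \<open>s\<close> is the row of the point that \<open>g\<close> moves to
  \<open>s\<close>. For \<open>g\<close> in \<open>Sym X\<close>, multiplication on the right by a
  row permutation preserves the word on \<open>X\<close>, so words index the left cosets of the row
  group.\<close>

definition word :: "(nat \<Rightarrow> nat) \<Rightarrow> fsym \<Rightarrow> nat \<Rightarrow> nat" where
  "word \<rho> g s = \<rho> (app (- g) s)"

text \<open>The columns are read off the word and pulled back along \<open>g\<close>. That
  \<open>g\<close> increases down the columns is what makes \<open>code_young_sym_le\<close>
  work.\<close>

lemma tableau_of_lattice_word:
  assumes X: "finite X" and g: "g \<in> Sym X" and w: "lattice_word X (word \<rho> g)"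
  defines "\<kappa> \<equiv> \<lambda>x. occurrence X (word \<rho> g) (app g x)"
  shows "tableau X \<rho> \<kappa>"
    and "\<And>x y. x \<in> X \<Longrightarrow> y \<in> X \<Longrightarrow> \<kappa> x = \<kappa> y \<Longrightarrow> \<rho> x < \<rho> y \<Longrightarrow> app g x < app g y"
proof -
  have wg: "word \<rho> g (app g x) = \<rho> x" for x by (simp add: word_def)
  have gX: "app g x \<in> X \<longleftrightarrow> x \<in> X" for x by (rule Sym_app_in[OF g])
  have "inj_on (\<lambda>x. (\<rho> x, \<kappa> x)) X"
  proof (rule inj_onI)
    fix x y assume xy: "x \<in> X" "y \<in> X" "(\<rho> x, \<kappa> x) = (\<rho> y, \<kappa> y)"
    have "app g x = app g y"
      by (rule occurrence_inj[OF X, where w = "word \<rho> g"]) (use xy in \<open>auto simp: gX wg \<kappa>_def\<close>)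
    then show "x = y" by simp
  qed
  moreover have "(\<lambda>x. (\<rho> x, \<kappa> x)) ` X = (\<lambda>s. (word \<rho> g s, occurrence X (word \<rho> g) s)) ` (app g ` X)"
    by (simp add: image_image wg \<kappa>_def)
  ultimately show "tableau X \<rho> \<kappa>"
    using lattice_word_young[OF X w] by (simp add: tableau_def Sym_image_eq[OF g])
  show "app g x < app g y" if "x \<in> X" "y \<in> X" "\<kappa> x = \<kappa> y" "\<rho> x < \<rho> y" for x y
    by (rule lattice_word_column[OF X w]) (use that in \<open>simp_all add: gX wg \<kappa>_def\<close>)
qed

section \<open>Leading words\<close>

definition colour_size :: "nat set \<Rightarrow> (nat \<Rightarrow> nat) \<Rightarrow> nat \<Rightarrow> nat" where
  "colour_size X \<rho> i = card {s \<in> X. \<rho> s = i}"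

text \<open>The second colouring \<open>\<rho>'\<close> is the larger one. Row sizes are compared in
  the given order of rows, without sorting.\<close>

definition lex_larger :: "nat set \<Rightarrow> (nat \<Rightarrow> nat) \<Rightarrow> (nat \<Rightarrow> nat) \<Rightarrow> bool" where
  "lex_larger X \<rho> \<rho>' \<longleftrightarrow>
    (\<exists>i. colour_size X \<rho> i < colour_size X \<rho>' i \<and> (\<forall>j<i. colour_size X \<rho>' j = colour_size X \<rho> j))"

text \<open>Confines the colours to the first \<open>card X\<close> numbers, so that a shape can be
  coded by that many digits; see \<open>lex_larger_code_less\<close>.\<close>

definition gapfree :: "nat set \<Rightarrow> (nat \<Rightarrow> nat) \<Rightarrow> bool" where
  "gapfree X \<rho> \<longleftrightarrow> (\<exists>k. \<rho> ` X = {..<k})"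

lemma card_less_colour_sizes:
  assumes "finite X"
  shows "card {s \<in> X. \<rho> s < m} = (\<Sum>j<m. colour_size X \<rho> j)"
proof -
  have "(\<Sum>j<m. sum (\<lambda>_. 1) {s \<in> {s \<in> X. \<rho> s < m}. \<rho> s = j}) = sum (\<lambda>_. 1 :: nat) {s \<in> X. \<rho> s < m}"
    using assms by (intro sum.group) auto
  moreover have "{s \<in> {s \<in> X. \<rho> s < m}. \<rho> s = j} = {s \<in> X. \<rho> s = j}" if "j < m" for j
    using that by auto
  ultimately show ?thesis by (simp add: colour_size_def)
qed

text \<open>If the product were nonzero, dominance would bound the partial sums of the row sizes of
  \<open>\<rho>'\<close> by those of \<open>\<rho>\<close>. This fails at the first row where the
  sizes differ, since there \<open>\<rho>'\<close> is larger.\<close>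

lemma col_single_row_sym_lex_larger:
  assumes X: "finite X" "X \<subseteq> {1..}" and T: "tableau X \<rho> \<kappa>" and lex: "lex_larger X \<rho> \<rho>'"
    and \<sigma>: "\<sigma> \<in> Sym X"
  shows "(col_sym X \<kappa> :: fsym \<Rightarrow>\<^sub>0 'k::field_char_0) * single \<sigma> 1 * row_sym X \<rho>' = 0"
proof (rule ccontr)
  assume neq: "\<not> ?thesis"
  define \<rho>'' where "\<rho>'' s = \<rho>' (app (- \<sigma>) s)" for s
  have "(col_sym X \<kappa> :: fsym \<Rightarrow>\<^sub>0 'k) * single \<sigma> 1 * row_sym X \<rho>' =
      col_sym X \<kappa> * row_sym X \<rho>'' * single \<sigma> 1"
    unfolding mult.assoc row_sym_conj_Sym[OF \<sigma>] by (simp add: \<rho>''_def[abs_def])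
  with neq have "(col_sym X \<kappa> :: fsym \<Rightarrow>\<^sub>0 'k) * row_sym X \<rho>'' \<noteq> 0" by auto
  then have inj: "inj_on (\<lambda>s. (\<rho>'' s, \<kappa> s)) X" by (rule col_row_sym_nonzero_imp_inj[OF X])
  have le: "(\<Sum>j<m. colour_size X \<rho>' j) \<le> (\<Sum>j<m. colour_size X \<rho> j)" for m
  proof -
    have "card {s \<in> X. \<rho>'' s < m} = card {s \<in> X. \<rho>' s < m}"
      unfolding \<rho>''_def by (rule card_Sym_image[OF \<sigma>, of "\<lambda>s. \<rho>' s < m"])
    then show ?thesis
      using tableau_dominates[OF X(1) T inj, of m] by (simp add: card_less_colour_sizes[OF X(1)])
  qed
  obtain i where i: "colour_size X \<rho> i < colour_size X \<rho>' i"
    "\<And>j. j < i \<Longrightarrow> colour_size X \<rho>' j = colour_size X \<rho> j"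
    using lex by (auto simp: lex_larger_def)
  have "(\<Sum>j<i. colour_size X \<rho>' j) = (\<Sum>j<i. colour_size X \<rho> j)"
    using i(2) by (intro sum.cong) auto
  then show False using le[of "Suc i"] i(1) by simp
qed

lemma young_row_sym_lex_larger:
  assumes X: "finite X" "X \<subseteq> {1..}" and T: "tableau X \<rho> \<kappa>" and lex: "lex_larger X \<rho> \<rho>'"
  shows "(young_sym X \<rho> \<kappa> :: fsym \<Rightarrow>\<^sub>0 'k::field_char_0) * row_sym X \<rho>' = 0"
proof -
  have "(young_sym X \<rho> \<kappa> :: fsym \<Rightarrow>\<^sub>0 'k) * row_sym X \<rho>' =
      (\<Sum>\<sigma>\<in>colour_group X \<rho>. col_sym X \<kappa> * single \<sigma> 1 * row_sym X \<rho>')"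
    unfolding young_sym_def row_sym_def[of X \<rho>] symmetrizer_def
    by (simp add: sum_distrib_left sum_distrib_right)
  also have "\<dots> = 0"
    using col_single_row_sym_lex_larger[OF assms] by (intro sum.neutral) (auto simp: colour_group_def)
  finally show ?thesis .
qed

lemma lookup_times_row_sym:
  "lookup (y * row_sym X \<rho>) g = (\<Sum>r\<in>colour_group X \<rho>. lookup y (g - r))"
  by (simp add: row_sym_def symmetrizer_def sum_distrib_left lookup_sum lookup_times_single)

lemma finite_colour_group: "finite X \<Longrightarrow> finite (colour_group X \<rho>)"
  using subgrp_colour_group by (auto simp: subgrp_def)

lemma lookup_young_sym:
  assumes "finite X"
  shows "lookup (young_sym X \<rho> \<kappa> :: fsym \<Rightarrow>\<^sub>0 'k::field_char_0) h =
    (\<Sum>c\<in>colour_group X \<kappa>. if - c + h \<in> colour_group X \<rho> then psgn c else 0)"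
proof -
  have "young_sym X \<rho> \<kappa> = (\<Sum>c\<in>colour_group X \<kappa>. single c (psgn c) * row_sym X \<rho> :: fsym \<Rightarrow>\<^sub>0 'k)"
    unfolding young_sym_def col_sym_def symmetrizer_def sum_distrib_right ..
  then have "lookup (young_sym X \<rho> \<kappa> :: fsym \<Rightarrow>\<^sub>0 'k) h =
      (\<Sum>c\<in>colour_group X \<kappa>. lookup (single c (psgn c) * row_sym X \<rho>) h)"
    by (simp add: lookup_sum)
  also have "\<dots> = (\<Sum>c\<in>colour_group X \<kappa>. if - c + h \<in> colour_group X \<rho> then psgn c else 0)"
    by (intro sum.cong refl)
      (simp add: lookup_single_times row_sym_def lookup_symmetrizer finite_colour_group[OF assms])
  finally show ?thesis .
qed

lemma colour_group_Int:
  assumes "inj_on (\<lambda>s. (\<rho> s, \<kappa> s)) X" "g \<in> colour_group X \<rho>" "g \<in> colour_group X \<kappa>"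
  shows "g = 0"
proof (rule fsym_eqI)
  fix s
  have S: "g \<in> Sym X" using assms(2) by (simp add: colour_group_def)
  show "app g s = app 0 s"
  proof (cases "s \<in> X")
    case True
    have "(\<rho> (app g s), \<kappa> (app g s)) = (\<rho> s, \<kappa> s)"
      using assms(2,3) True by (simp add: colour_group_def)
    then have "app g s = s"
      using inj_onD[OF assms(1)] True Sym_app_in[OF S] by blast
    then show ?thesis by simp
  next
    case False
    then show ?thesis using S by (simp add: Sym_def)
  qed
qed

text \<open>Row and column group meet trivially, so the identity factors in only one way. The value
  1 is what lets the translate in \<open>killed_in_subideal\<close> cancel a leading coefficient
  exactly.\<close>

lemma lookup_young_sym_0:
  assumes X: "finite X" and T: "tableau X \<rho> \<kappa>"
  shows "lookup (young_sym X \<rho> \<kappa> :: fsym \<Rightarrow>\<^sub>0 'k::field_char_0) 0 = 1"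
proof -
  have "- c \<in> colour_group X \<rho> \<longleftrightarrow> c = 0" if "c \<in> colour_group X \<kappa>" for c
  proof
    assume "- c \<in> colour_group X \<rho>"
    moreover have "inj_on (\<lambda>s. (\<rho> s, \<kappa> s)) X" using T by (simp add: tableau_def)
    ultimately have "- c = 0" using colour_group_uminus[OF that] colour_group_Int by blast
    then show "c = 0" by simp
  next
    assume "c = 0"
    then show "- c \<in> colour_group X \<rho>"
      using subgrp_colour_group[OF X] by (simp add: subgrp_def)
  qed
  then have "lookup (young_sym X \<rho> \<kappa> :: fsym \<Rightarrow>\<^sub>0 'k) 0 =
      (\<Sum>c\<in>colour_group X \<kappa>. if c = 0 then 1 else 0)"
    unfolding lookup_young_sym[OF X] by (intro sum.cong refl) simp
  also have "\<dots> = 1"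
    using subgrp_colour_group[OF X, of \<kappa>] by (simp add: subgrp_def)
  finally show ?thesis .
qed

lemma keys_Sym_mult:
  assumes "finite X" "keys x \<subseteq> Sym X" "keys y \<subseteq> Sym X"
  shows "keys (x * y) \<subseteq> Sym X"
proof -
  have "a + b \<in> Sym X" if "a \<in> keys x" "b \<in> keys y" for a b
    using that assms(2,3) subgrp_Sym[OF assms(1)] unfolding subgrp_def by blast
  then show ?thesis using keys_mult[of x y] by blast
qed

lemma keys_row_sym: "finite X \<Longrightarrow> keys (row_sym X \<rho>) \<subseteq> Sym X"
  unfolding row_sym_def using keys_symmetrizer[OF finite_colour_group] by (fastforce simp: colour_group_def)

lemma keys_col_sym: "finite X \<Longrightarrow> keys (col_sym X \<rho>) \<subseteq> Sym X"
  unfolding col_sym_def using keys_symmetrizer[OF finite_colour_group] by (fastforce simp: colour_group_def)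

lemma keys_young_sym: "finite X \<Longrightarrow> keys (young_sym X \<rho> \<kappa>) \<subseteq> Sym X"
  unfolding young_sym_def by (intro keys_Sym_mult keys_row_sym keys_col_sym)

lemma keys_diff_subset: "keys x \<subseteq> A \<Longrightarrow> keys y \<subseteq> A \<Longrightarrow> keys (x - y) \<subseteq> A"
  using keys_diff[of x y] by blast

text \<open>Turns the comparison of words by their last disagreement into the order of
  \<open>nat\<close>, which serves for leading words and for induction. The base exceeds every
  letter.\<close>

definition code :: "nat set \<Rightarrow> (nat \<Rightarrow> nat) \<Rightarrow> fsym \<Rightarrow> nat" where
  "code X \<rho> g = (\<Sum>s\<in>X. word \<rho> g s * Suc (Max (\<rho> ` X)) ^ s)"

lemma word_less_Max:
  assumes "finite X" "g \<in> Sym X" "s \<in> X"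
  shows "word \<rho> g s < Suc (Max (\<rho> ` X))"
  using assms Sym_app_uminus_in[of g X s] by (simp add: word_def less_Suc_eq_le)

lemma code_less_word:
  assumes "finite X" "g \<in> Sym X" "s \<in> X" "word \<rho> g s < word \<rho> h s"
    and "\<And>t. t \<in> X \<Longrightarrow> s < t \<Longrightarrow> word \<rho> g t = word \<rho> h t"
  shows "code X \<rho> g < code X \<rho> h"
  unfolding code_def using assms word_less_Max[OF assms(1,2)] by (intro code_less[of X s]) auto

text \<open>
  If the leading word of \<open>y\<close> violates the lattice condition at \<open>m\<close>, then the positions
  carrying \<open>i\<close> after \<open>m\<close> or \<open>i + 1\<close> up to \<open>m\<close> outnumber row \<open>i\<close>. Symmetrizing over them
  alone, with the smaller colours, kills \<open>y\<close>, yet moves the leading word upwards only.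
\<close>

lemma leading_word_lattice:
  fixes y :: "fsym \<Rightarrow>\<^sub>0 'k::field_char_0"
  assumes X: "finite X" and gf: "gapfree X \<rho>"
    and inv: "\<And>h r. r \<in> colour_group X \<rho> \<Longrightarrow> lookup y (h - r) = lookup y h"
    and kill: "\<And>\<rho>'. gapfree X \<rho>' \<Longrightarrow> lex_larger X \<rho> \<rho>' \<Longrightarrow> y * row_sym X \<rho>' = 0"
    and g: "g \<in> Sym X" "lookup y g \<noteq> 0"
    and max: "\<And>h. lookup y h \<noteq> 0 \<Longrightarrow> code X \<rho> h \<le> code X \<rho> g"
  shows "lattice_word X (word \<rho> g)"
  unfolding lattice_word_def
proof (intro allI, rule ccontr)
  fix i m
  let ?w = "word \<rho> g"
  assume "\<not> card {s \<in> X. s \<le> m \<and> ?w s = Suc i} \<le> card {s \<in> X. s \<le> m \<and> ?w s = i}"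
  then have viol: "card {s \<in> X. s \<le> m \<and> ?w s = i} < card {s \<in> X. s \<le> m \<and> ?w s = Suc i}" by simp
  define Z' where "Z' = {s \<in> X. m < s \<and> ?w s = i \<or> s \<le> m \<and> ?w s = Suc i}"
  define Z where "Z = {x \<in> X. app g x \<in> Z'}"
  define rest where "rest = {x \<in> X. x \<notin> Z \<and> i \<le> \<rho> x}"
  have wg: "?w (app g x) = \<rho> x" for x by (simp add: word_def)
  have gX: "app g x \<in> X \<longleftrightarrow> x \<in> X" "app (- g) x \<in> X \<longleftrightarrow> x \<in> X" for x
    using Sym_app_in[OF g(1)] Sym_app_uminus_in[OF g(1)] by auto
  have Z: "\<rho> x = i \<or> \<rho> x = Suc i" if "x \<in> Z" for x
    using that by (auto simp: Z_def Z'_def wg)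
  have "finite rest" using X by (simp add: rest_def)
  then obtain e where e: "bij_betw e rest {0..<card rest}" using ex_bij_betw_finite_nat by blast
  \<comment> \<open>Rows with index less than \<open>i\<close> are kept, \<open>Z\<close> becomes
    row \<open>i\<close>, and each remaining point gets a row to itself. The new group thus permutes
    \<open>Z\<close> and the kept rows and fixes all remaining points.\<close>
  define \<rho>' where "\<rho>' x = (if x \<in> Z then i else if \<rho> x < i then \<rho> x else Suc i + e x)" for x
  have \<rho>'_less: "\<rho>' x < i \<longleftrightarrow> \<rho> x < i" "\<rho> x < i \<Longrightarrow> \<rho>' x = \<rho> x" for x
    using Z[of x] by (auto simp: \<rho>'_def)
  have \<rho>'_Z: "\<rho>' x = i \<longleftrightarrow> x \<in> Z" for x by (simp add: \<rho>'_def)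

  \<comment> \<open>Up to \<open>m\<close> the letters \<open>i\<close> of row \<open>i\<close> are
    exchanged for the letters \<open>i + 1\<close>, which are more numerous by the
    violation.\<close>
  have cZ: "colour_size X \<rho> i < card Z"
  proof -
    have "bij_betw (app g) Z Z'"
      by (rule bij_betwI[where g = "app (- g)"]) (auto simp: Z_def Z'_def gX)
    then have "card Z = card Z'" by (rule bij_betw_same_card)
    also have "Z' = {s \<in> X. m < s \<and> ?w s = i} \<union> {s \<in> X. s \<le> m \<and> ?w s = Suc i}"
      by (auto simp: Z'_def)
    also have "card \<dots> = card {s \<in> X. m < s \<and> ?w s = i} + card {s \<in> X. s \<le> m \<and> ?w s = Suc i}"
      using X by (intro card_Un_disjoint) auto
    also have "\<dots> > card {s \<in> X. m < s \<and> ?w s = i} + card {s \<in> X. s \<le> m \<and> ?w s = i}"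
      using viol by simp
    also have "card {s \<in> X. m < s \<and> ?w s = i} + card {s \<in> X. s \<le> m \<and> ?w s = i} =
        card ({s \<in> X. m < s \<and> ?w s = i} \<union> {s \<in> X. s \<le> m \<and> ?w s = i})"
      using X by (intro card_Un_disjoint[symmetric]) auto
    also have "{s \<in> X. m < s \<and> ?w s = i} \<union> {s \<in> X. s \<le> m \<and> ?w s = i} = {s \<in> X. ?w s = i}"
      by auto
    also have "card \<dots> = colour_size X \<rho> i"
      unfolding colour_size_def word_def by (rule card_Sym_image[OF g(1)])
    finally show ?thesis .
  qed

  have "lex_larger X \<rho> \<rho>'"
    unfolding lex_larger_def
  proof (intro exI[of _ i] conjI allI impI)
    have "{s \<in> X. \<rho>' s = i} = Z" by (auto simp: \<rho>'_Z) (simp add: Z_def)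
    then show "colour_size X \<rho> i < colour_size X \<rho>' i" using cZ by (simp add: colour_size_def)
    fix j assume j: "j < i"
    have "\<rho>' s = j \<longleftrightarrow> \<rho> s = j" for s using \<rho>'_less[of s] j by auto
    then show "colour_size X \<rho>' j = colour_size X \<rho> j" by (simp add: colour_size_def)
  qed
  moreover have "gapfree X \<rho>'"
    unfolding gapfree_def
  proof (intro exI[of _ "Suc i + card rest"] equalityI subsetI)
    fix c assume "c \<in> \<rho>' ` X"
    then obtain x where x: "x \<in> X" "c = \<rho>' x" by blast
    show "c \<in> {..<Suc i + card rest}"
    proof (cases "x \<in> rest")
      case True
      then have "e x < card rest" using bij_betwE[OF e] by auto
      moreover have "c = Suc i + e x" using True x by (simp add: rest_def \<rho>'_def)
      ultimately show ?thesis by simp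
    next
      case False
      then have "c \<le> i" using x \<rho>'_less[of x] by (auto simp: rest_def \<rho>'_def)
      then show ?thesis by simp
    qed
  next
    fix c assume c: "c \<in> {..<Suc i + card rest}"
    obtain k where k: "\<rho> ` X = {..<k}" using gf by (auto simp: gapfree_def)
    \<comment> \<open>The violation exhibits the letter \<open>i + 1\<close>; hence
      \<open>\<rho>\<close> uses every colour less than \<open>i\<close>, and \<open>\<rho>'\<close>
      keeps these.\<close>
    have "{s \<in> X. s \<le> m \<and> ?w s = Suc i} \<noteq> {}" using viol by fastforce
    then obtain s where "s \<in> X" "?w s = Suc i" by blast
    then have "Suc i \<in> \<rho> ` X" by (auto simp: word_def gX intro!: image_eqI[of _ _ "app (- g) s"])
    then have ik: "Suc i < k" using k by simp
    consider "c < i" | "c = i" | j where "c = Suc i + j" "j < card rest"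
    proof -
      have "c < i \<or> c = i \<or> (c = Suc i + (c - Suc i) \<and> c - Suc i < card rest)"
        using c by auto
      then show thesis using that by blast
    qed
    then show "c \<in> \<rho>' ` X"
    proof cases
      case 1
      then have "c \<in> \<rho> ` X" using ik k by simp
      then obtain x where "x \<in> X" "\<rho> x = c" by blast
      then show ?thesis using 1 \<rho>'_less(2)[of x] by (intro image_eqI[of _ _ x]) auto
    next
      case 2
      have "Z \<noteq> {}" using cZ by auto
      then obtain x where "x \<in> Z" by blast
      then have "x \<in> X" "c = \<rho>' x" using 2 \<rho>'_Z[of x] by (simp_all add: Z_def)
      then show ?thesis by blast
    next
      case 3
      then have "j \<in> e ` rest" using e by (simp add: bij_betw_def)
      then obtain x where x: "x \<in> rest" "j = e x" by blast
      then have "\<rho>' x = Suc i + j" by (simp add: rest_def \<rho>'_def)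
      then show ?thesis using 3 x by (intro image_eqI[of _ _ x]) (simp_all add: rest_def)
    qed
  qed
  ultimately have "y * row_sym X \<rho>' = 0" by (intro kill)
  then have sum0: "(\<Sum>r\<in>colour_group X \<rho>'. lookup y (g - r)) = 0"
    by (simp flip: lookup_times_row_sym)

  have zero: "lookup y (g - r) = 0" if r: "r \<in> colour_group X \<rho>'" "r \<notin> colour_group X \<rho>" for r
  proof (rule ccontr)
    assume "lookup y (g - r) \<noteq> 0"
    then have le: "code X \<rho> (g - r) \<le> code X \<rho> g" by (rule max)
    let ?v = "word \<rho> (g - r)"
    have rS: "r \<in> Sym X" and r': "\<And>x. x \<in> X \<Longrightarrow> \<rho>' (app r x) = \<rho>' x"
      using r(1) by (auto simp: colour_group_def)
    have rX: "app r x \<in> X \<longleftrightarrow> x \<in> X" for x by (rule Sym_app_in[OF rS])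
    have v: "?v s = \<rho> (app r (app (- g) s))" for s by (simp add: word_def minus_diff_eq)
    have out: "?v s = ?w s" if s: "s \<in> X" "s \<notin> Z'" for s
    proof -
      let ?x = "app (- g) s"
      have x: "?x \<in> X" "?x \<notin> Z" using s by (auto simp: gX Z_def)
      show ?thesis
      proof (cases "\<rho> ?x < i")
        case True
        then show ?thesis
          using r'[OF x(1)] \<rho>'_less[of ?x] \<rho>'_less[of "app r ?x"] by (simp add: v word_def)
      next
        case False
        have eq: "\<rho>' (app r ?x) = Suc i + e ?x"
          using r'[OF x(1)] x(2) False by (simp add: \<rho>'_def)
        then have "app r ?x \<notin> Z" "\<not> \<rho> (app r ?x) < i"
          using \<rho>'_Z[of "app r ?x"] \<rho>'_less(1)[of "app r ?x"] by auto
        then have "app r ?x \<in> rest" "e (app r ?x) = e ?x"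
          using eq x by (auto simp: rest_def \<rho>'_def rX)
        moreover have "?x \<in> rest" using x False by (simp add: rest_def)
        ultimately have "app r ?x = ?x" using e by (metis bij_betw_def inj_onD)
        then show ?thesis by (simp add: v word_def)
      qed
    qed
    have inZ: "?v s = i \<or> ?v s = Suc i" if s: "s \<in> Z'" for s
    proof -
      have "app (- g) s \<in> X" "app (- g) s \<in> Z"
        using s by (simp_all add: Z_def gX) (simp_all add: Z'_def)
      then have "app r (app (- g) s) \<in> Z" using r' \<rho>'_Z by metis
      then show ?thesis using Z by (simp add: v)
    qed
    obtain x where x: "x \<in> X" "\<rho> (app r x) \<noteq> \<rho> x"
      using r(2) rS by (auto simp: colour_group_def)
    then have gx: "app g x \<in> X" "?w (app g x) \<noteq> ?v (app g x)" by (simp_all add: gX wg v)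
    obtain s where s: "s \<in> X" "?w s \<noteq> ?v s" and agree: "\<And>t. t \<in> X \<Longrightarrow> s < t \<Longrightarrow> ?w t = ?v t"
      using last_disagreement[where u = ?w and v = ?v, OF X gx] by metis
    \<comment> \<open>Both words have only the letters \<open>i\<close> and \<open>i + 1\<close> on
      \<open>Z'\<close> and agree elsewhere. A drop at \<open>s\<close> requires \<open>s\<close> to
      be at most \<open>m\<close>, so the letters \<open>i\<close> in \<open>Z'\<close>, all after
      \<open>m\<close>, are untouched. Then \<open>?v\<close> has more letters \<open>i\<close> than
      row \<open>i\<close> has points.\<close>
    have "?w s < ?v s"
    proof (rule ccontr)
      assume "\<not> ?w s < ?v s"
      moreover have sZ: "s \<in> Z'" using out s by metis
      moreover have "?w s = i \<or> ?w s = Suc i" using sZ by (auto simp: Z'_def)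
      ultimately have ws: "?w s = Suc i" "?v s = i" using inZ[of s] s(2) by auto
      then have sm: "s \<le> m" using sZ by (auto simp: Z'_def)
      have "t \<in> {t \<in> X. ?v t = i}" if t: "t \<in> {t \<in> X. ?w t = i}" for t
      proof (cases "t \<in> Z'")
        case True
        then have "s < t" using t sm by (auto simp: Z'_def)
        then show ?thesis using agree[of t] t by simp
      next
        case False
        then show ?thesis using out[of t] t by simp
      qed
      then have "{t \<in> X. ?w t = i} \<subseteq> {t \<in> X. ?v t = i}" by (rule subsetI)
      moreover have "s \<notin> {t \<in> X. ?w t = i}" "s \<in> {t \<in> X. ?v t = i}" using ws s(1) by simp_all
      ultimately have "{t \<in> X. ?w t = i} \<subset> {t \<in> X. ?v t = i}" by blast
      then have "card {t \<in> X. ?w t = i} < card {t \<in> X. ?v t = i}"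
        using X by (intro psubset_card_mono) auto
      moreover have "card {t \<in> X. word \<rho> h t = i} = colour_size X \<rho> i" if "h \<in> Sym X" for h
        unfolding colour_size_def word_def by (rule card_Sym_image[OF that])
      moreover have "g - r \<in> Sym X"
        using g(1) Sym_uminus[OF rS] subgrp_Sym[OF X]
        unfolding subgrp_def add_uminus_conv_diff[symmetric] by blast
      ultimately show False using g(1) by simp
    qed
    then have "code X \<rho> g < code X \<rho> (g - r)"
      using agree by (intro code_less_word[OF X g(1) s(1)]) auto
    with le show False by simp
  qed
  \<comment> \<open>Each surviving term equals \<open>lookup y g\<close>, and the identity
    contributes one. In characteristic 0 their sum cannot vanish.\<close>
  have "(\<Sum>r\<in>colour_group X \<rho>'. lookup y (g - r)) =
      (\<Sum>r\<in>colour_group X \<rho>' \<inter> colour_group X \<rho>. lookup y (g - r))"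
    using finite_colour_group[OF X] zero by (intro sum.mono_neutral_right) auto
  also have "\<dots> = of_nat (card (colour_group X \<rho>' \<inter> colour_group X \<rho>)) * lookup y g"
    using inv by simp
  finally have "of_nat (card (colour_group X \<rho>' \<inter> colour_group X \<rho>)) * lookup y g = 0"
    using sum0 by simp
  moreover have "0 \<in> colour_group X \<rho>' \<inter> colour_group X \<rho>"
    using subgrp_colour_group[OF X] unfolding subgrp_def by blast
  then have "card (colour_group X \<rho>' \<inter> colour_group X \<rho>) > 0"
    unfolding card_gt_0_iff using finite_colour_group[OF X, of \<rho>] by blast
  ultimately show False using g(2) by simp
qed

section \<open>Completeness of the Young symmetrizers\<close>

text \<open>Two-sided ideals of the group algebra of the finite group \<open>Sym X\<close>, viewed
  as subsets of the full algebra.\<close>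

definition subideal :: "nat set \<Rightarrow> (fsym \<Rightarrow>\<^sub>0 'k::field_char_0) set \<Rightarrow> bool" where
  "subideal X W \<longleftrightarrow> 0 \<in> W \<and> (\<forall>x\<in>W. \<forall>y\<in>W. x + y \<in> W) \<and> (\<forall>x\<in>W. keys x \<subseteq> Sym X) \<and>
    (\<forall>x\<in>W. \<forall>z. keys z \<subseteq> Sym X \<longrightarrow> z * x \<in> W \<and> x * z \<in> W)"

lemma lookup_right_invariant:
  fixes y :: "fsym \<Rightarrow>\<^sub>0 'k::semiring_1"
  assumes "y * single r 1 = y"
  shows "lookup y (h - r) = lookup y h"
  using lookup_times_single[of y r 1 h] assms by simp

text \<open>
  Column operations lower the word read off by \<open>g\<close>, because \<open>g\<close> increases along columns.
\<close>

lemma code_young_sym_le: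
  assumes X: "finite X" and h: "h \<in> Sym X"
    and inc: "\<And>x y. x \<in> X \<Longrightarrow> y \<in> X \<Longrightarrow> \<kappa> x = \<kappa> y \<Longrightarrow> \<rho> x < \<rho> y \<Longrightarrow> app g x < app g y"
    and T: "tableau X \<rho> \<kappa>" and g: "g \<in> Sym X"
    and nz: "lookup (young_sym X \<rho> \<kappa> :: fsym \<Rightarrow>\<^sub>0 'k::field_char_0) (- g + h) \<noteq> 0"
  shows "code X \<rho> h \<le> code X \<rho> g"
proof -
  obtain c where c: "c \<in> colour_group X \<kappa>" "- c + (- g + h) \<in> colour_group X \<rho>"
    using nz unfolding lookup_young_sym[OF X]
    by (rule sum.not_neutral_contains_not_neutral) (simp split: if_splits)
  have cS: "c \<in> Sym X" and c\<kappa>: "\<And>x. x \<in> X \<Longrightarrow> \<kappa> (app (- c) x) = \<kappa> x"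
    using c(1) colour_group_uminus[OF c(1)] by (auto simp: colour_group_def)
  have v: "word \<rho> h s = \<rho> (app (- c) (app (- g) s))" if "s \<in> X" for s
  proof -
    have "app (- h) s \<in> X" using Sym_app_uminus_in[OF h] that by simp
    then have "\<rho> (app (- c + (- g + h)) (app (- h) s)) = \<rho> (app (- h) s)"
      using c(2) unfolding colour_group_def by blast
    then show ?thesis by (simp add: word_def)
  qed
  show ?thesis
  proof (cases "\<forall>s\<in>X. word \<rho> h s = word \<rho> g s")
    case True
    then show ?thesis unfolding code_def by (intro eq_refl sum.cong) auto
  next
    case False
    then obtain x0 where "x0 \<in> X" "word \<rho> h x0 \<noteq> word \<rho> g x0" by blast
    then obtain s where s: "s \<in> X" "word \<rho> h s \<noteq> word \<rho> g s"
      "\<And>t. t \<in> X \<Longrightarrow> s < t \<Longrightarrow> word \<rho> h t = word \<rho> g t"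
      using last_disagreement[where u = "word \<rho> h" and v = "word \<rho> g", OF X] by metis
    have "word \<rho> h s < word \<rho> g s"
    proof (rule ccontr)
      assume "\<not> ?thesis"
      then have gt: "word \<rho> g s < word \<rho> h s" using s(2) by simp
      \<comment> \<open>The inverse column permutation takes \<open>x\<close> to a lower cell
        \<open>x'\<close> of its column. As \<open>g\<close> increases down columns, it puts
        \<open>x'\<close> after \<open>s\<close>, where the words agree. So \<open>- c\<close> fixes
        \<open>x'\<close>, which forces \<open>x' = x\<close>.\<close>
      define x where "x = app (- g) s"
      define x' where "x' = app (- c) x"
      have x: "x \<in> X" "x' \<in> X"
        using s(1) Sym_app_uminus_in[OF g] Sym_app_uminus_in[OF cS] by (simp_all add: x_def x'_def)
      have k: "\<kappa> x' = \<kappa> x" using c\<kappa>[OF x(1)] by (simp add: x'_def)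
      have "\<rho> x < \<rho> x'" using gt v[OF s(1)] by (simp add: word_def x_def x'_def)
      then have "app g x < app g x'" using inc x k by simp
      then have "s < app g x'" by (simp add: x_def)
      moreover have gx': "app g x' \<in> X" using Sym_app_in[OF g] x(2) by simp
      ultimately have "word \<rho> h (app g x') = word \<rho> g (app g x')" by (intro s(3))
      then have "\<rho> (app (- c) x') = \<rho> x'" unfolding v[OF gx'] by (simp add: word_def)
      moreover have "app (- c) x' \<in> X" using x(2) Sym_app_uminus_in[OF cS] by simp
      ultimately have "app (- c) x' = x'"
        using T c\<kappa>[OF x(2)] x(2) unfolding tableau_def by (auto dest: inj_onD)
      then have "x' = x" unfolding x'_def by simp
      then show False using \<open>\<rho> x < \<rho> x'\<close> by simp
    qed
    then have "code X \<rho> h < code X \<rho> g" using code_less_word[OF X h s(1) _ s(3)] by blast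
    then show ?thesis by simp
  qed
qed

text \<open>Induction on a strict bound \<open>m\<close> for the codes in the support. Subtracting
  \<open>e\<close> removes the whole coset of the leading word and adds no larger word; the
  difference is still right invariant and killed by the larger row symmetrizers.\<close>

lemma killed_in_subideal:
  fixes y :: "fsym \<Rightarrow>\<^sub>0 'k::field_char_0"
  assumes X: "finite X" "X \<subseteq> {1..}" and gf: "gapfree X \<rho>" and W: "subideal X W"
    and T: "\<And>\<kappa>. tableau X \<rho> \<kappa> \<Longrightarrow> young_sym X \<rho> \<kappa> \<in> W"
    and y: "keys y \<subseteq> Sym X" "\<And>r. r \<in> colour_group X \<rho> \<Longrightarrow> y * single r 1 = y"
    "\<And>\<rho>'. gapfree X \<rho>' \<Longrightarrow> lex_larger X \<rho> \<rho>' \<Longrightarrow> y * row_sym X \<rho>' = 0"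
  shows "y \<in> W"
proof -
  have "y \<in> W" if "\<And>h. lookup y h \<noteq> 0 \<Longrightarrow> code X \<rho> h < m"
    "keys y \<subseteq> Sym X" "\<And>r. r \<in> colour_group X \<rho> \<Longrightarrow> y * single r 1 = y"
    "\<And>\<rho>'. gapfree X \<rho>' \<Longrightarrow> lex_larger X \<rho> \<rho>' \<Longrightarrow> y * row_sym X \<rho>' = 0"
    for m and y :: "fsym \<Rightarrow>\<^sub>0 'k"
    using that
  proof (induction m arbitrary: y)
    case 0
    then have "y = 0" by (intro poly_mapping_eqI) auto
    then show ?case using W by (simp add: subideal_def)
  next
    case (Suc m)
    have inv: "lookup y (h - r) = lookup y h" if "r \<in> colour_group X \<rho>" for h r
      by (rule lookup_right_invariant[OF Suc.prems(3)[OF that]])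
    show ?case
    proof (cases "\<exists>g. lookup y g \<noteq> 0 \<and> code X \<rho> g = m")
      case False
      then have "code X \<rho> h < m" if "lookup y h \<noteq> 0" for h
        using Suc.prems(1)[OF that] that less_SucE by blast
      then show ?thesis using Suc.IH Suc.prems by blast
    next
      case True
      then obtain g where g: "lookup y g \<noteq> 0" "code X \<rho> g = m" by blast
      then have gS: "g \<in> Sym X" using Suc.prems(2) by (auto simp: in_keys_iff)
      have max: "code X \<rho> h \<le> code X \<rho> g" if "lookup y h \<noteq> 0" for h
        using Suc.prems(1)[OF that] g(2) by simp
      have lat: "lattice_word X (word \<rho> g)"
        using leading_word_lattice[OF X(1) gf inv Suc.prems(4) gS g(1) max] .
      define \<kappa> where "\<kappa> x = occurrence X (word \<rho> g) (app g x)" for x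
      have tab: "tableau X \<rho> \<kappa>"
        using tableau_of_lattice_word(1)[OF X(1) gS lat] by (simp add: \<kappa>_def[abs_def])
      have inc: "app g x < app g y" if "x \<in> X" "y \<in> X" "\<kappa> x = \<kappa> y" "\<rho> x < \<rho> y" for x y
        using tableau_of_lattice_word(2)[OF X(1) gS lat] that by (simp add: \<kappa>_def)
      define e where "e = single g (lookup y g) * young_sym X \<rho> \<kappa>"
      have eW: "e \<in> W"
        using W T[OF tab] gS unfolding e_def subideal_def by auto
      have e: "lookup e h = lookup y g * lookup (young_sym X \<rho> \<kappa>) (- g + h)" for h
        by (simp add: e_def lookup_single_times)
      have eg: "lookup e g = lookup y g"
        by (simp add: e lookup_young_sym_0[OF X(1) tab])
      have ke: "keys e \<subseteq> Sym X" using W eW by (simp add: subideal_def)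
      have ky: "keys (y - e) \<subseteq> Sym X" using Suc.prems(2) ke by (rule keys_diff_subset)
      have e_inv: "e * single r 1 = e" if "r \<in> colour_group X \<rho>" for r
        by (simp add: e_def young_sym_def mult.assoc row_sym_absorb(2)[OF X(1) that])
      have y'_inv: "(y - e) * single r 1 = y - e" if "r \<in> colour_group X \<rho>" for r
        using Suc.prems(3)[OF that] e_inv[OF that] by (simp add: left_diff_distrib)
      have "y - e \<in> W"
      proof (rule Suc.IH)
        fix h assume h: "lookup (y - e) h \<noteq> 0"
        then have hS: "h \<in> Sym X" using ky by (auto simp: in_keys_iff)
        have "lookup y h \<noteq> 0 \<or> lookup e h \<noteq> 0" using h by (auto simp: lookup_minus)
        then have "code X \<rho> h \<le> m"
        proof
          assume "lookup y h \<noteq> 0" then show ?thesis using max g(2) by simp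
        next
          assume "lookup e h \<noteq> 0"
          then have "lookup (young_sym X \<rho> \<kappa> :: fsym \<Rightarrow>\<^sub>0 'k) (- g + h) \<noteq> 0" by (simp add: e)
          then show ?thesis using code_young_sym_le[OF X(1) hS inc tab gS] g(2) by blast
        qed
        \<comment> \<open>A code determines its word, so \<open>h\<close> would lie in the left
          coset of \<open>g\<close>. By right invariance \<open>y - e\<close> is constant on that
          coset, and it vanishes at \<open>g\<close>.\<close>
        moreover have "code X \<rho> h \<noteq> m"
        proof
          assume "code X \<rho> h = m"
          then have eq: "word \<rho> h s = word \<rho> g s" if "s \<in> X" for s
            using g(2) word_less_Max[OF X(1) hS] word_less_Max[OF X(1) gS] that unfolding code_def
            by (intro code_inj[OF X(1), of "word \<rho> h" "Suc (Max (\<rho> ` X))" "word \<rho> g"]) auto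
          have "- h + g \<in> Sym X"
            using Sym_uminus[OF hS] gS subgrp_Sym[OF X(1)] unfolding subgrp_def by blast
          moreover have "\<rho> (app (- h + g) x) = \<rho> x" if "x \<in> X" for x
            using eq[of "app g x"] Sym_app_in[OF gS] that by (simp add: word_def)
          ultimately have r: "- h + g \<in> colour_group X \<rho>" by (simp add: colour_group_def)
          have "g - (- h + g) = h"
            by (simp add: minus_add flip: add_uminus_conv_diff add.assoc)
          then have "lookup (y - e) h = lookup (y - e) g"
            using lookup_right_invariant[OF y'_inv[OF r], of g] by simp
          then show False using h eg by (simp add: lookup_minus)
        qed
        ultimately show "code X \<rho> h < m" by simp
      next
        fix \<rho>' assume "gapfree X \<rho>'" "lex_larger X \<rho> \<rho>'"
        then show "(y - e) * row_sym X \<rho>' = 0"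
          using Suc.prems(4) young_row_sym_lex_larger[OF X tab, where 'k = 'k]
          by (simp add: left_diff_distrib e_def mult.assoc)
      qed (fact ky y'_inv)+
      then have "(y - e) + e \<in> W" using W eW unfolding subideal_def by blast
      then show ?thesis by simp
    qed
  qed
  from this[of y "Suc (Max (code X \<rho> ` keys y))"] y show ?thesis
    by (auto simp: in_keys_iff less_Suc_eq_le)
qed

text \<open>The digits run backwards to make row 0 the most significant one.\<close>

lemma lex_larger_code_less:
  assumes X: "finite X" and gf: "gapfree X \<rho>'" and lex: "lex_larger X \<rho> \<rho>'"
  shows "(\<Sum>t<card X. colour_size X \<rho> (card X - 1 - t) * Suc (card X) ^ t) <
    (\<Sum>t<card X. colour_size X \<rho>' (card X - 1 - t) * Suc (card X) ^ t)"
proof -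
  obtain i where i: "colour_size X \<rho> i < colour_size X \<rho>' i"
    "\<And>j. j < i \<Longrightarrow> colour_size X \<rho>' j = colour_size X \<rho> j"
    using lex by (auto simp: lex_larger_def)
  obtain k where k: "\<rho>' ` X = {..<k}" using gf by (auto simp: gapfree_def)
  have "k \<le> card X" using card_image_le[OF X, of \<rho>'] k by simp
  moreover have "i \<in> \<rho>' ` X"
  proof (rule ccontr)
    assume "i \<notin> \<rho>' ` X"
    then have "{s \<in> X. \<rho>' s = i} = {}" by blast
    then have "colour_size X \<rho>' i = 0" unfolding colour_size_def by (simp only: card.empty)
    then show False using i(1) by simp
  qed
  ultimately have "i < card X" using k by simp
  moreover have "colour_size X \<rho> j < Suc (card X)" for j
    unfolding colour_size_def less_Suc_eq_le using X by (intro card_mono) auto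
  ultimately show ?thesis
    using i by (intro code_less[of _ "card X - 1 - i"]) auto
qed

text \<open>
  Modulo \<open>W\<close>, a row symmetrizer annihilates all lexicographically larger ones, by induction, so it
  lies in the span of its own Young symmetrizers.
\<close>

lemma one_in_subideal:
  fixes W :: "(fsym \<Rightarrow>\<^sub>0 'k::field_char_0) set"
  assumes X: "finite X" "X \<subseteq> {1..}" and W: "subideal X W"
    and T: "\<And>\<rho> \<kappa>. tableau X \<rho> \<kappa> \<Longrightarrow> young_sym X \<rho> \<kappa> \<in> W"
  shows "1 \<in> W"
proof -
  \<comment> \<open>Left multiplication by \<open>1 - f\<close> kills \<open>W\<close> and changes a
    row symmetrizer only by a member of \<open>W\<close>. This yields the exact vanishing that
    \<open>killed_in_subideal\<close> asks for.\<close>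
  obtain f where f: "f \<in> W" "\<And>x. x \<in> W \<Longrightarrow> f * x = x"
  proof -
    have "\<exists>f\<in>W. \<forall>x\<in>W. f * x = x"
      by (rule maschke[OF subgrp_Sym[OF X(1)]]) (use W in \<open>auto simp: subideal_def\<close>)
    then show thesis using that by blast
  qed
  have kf: "keys f \<subseteq> Sym X" using W f(1) by (simp add: subideal_def)
  have rows: "row_sym X \<rho> \<in> W" if "gapfree X \<rho>" for \<rho>
    using that
  \<comment> \<open>\<open>Suc (card X) ^ card X\<close> exceeds every code; subtracting from it
    lets lexicographically larger shapes come first.\<close>
  proof (induction \<rho> rule: measure_induct_rule[where f = "\<lambda>\<rho>. Suc (card X) ^ card X -
        (\<Sum>t<card X. colour_size X \<rho> (card X - 1 - t) * Suc (card X) ^ t)"])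
    case (less \<rho>)
    have IH: "row_sym X \<rho>' \<in> W" if gf: "gapfree X \<rho>'" and lex: "lex_larger X \<rho> \<rho>'" for \<rho>'
    proof -
      have "colour_size X \<rho>' j < Suc (card X)" for j
        unfolding colour_size_def less_Suc_eq_le using X(1) by (intro card_mono) auto
      then have "(\<Sum>t<card X. colour_size X \<rho>' (card X - 1 - t) * Suc (card X) ^ t) < Suc (card X) ^ card X"
        by (intro sum_power_less) auto
      then show ?thesis
        using lex_larger_code_less[OF X(1) gf lex] gf by (intro less.IH diff_less_mono2) auto
    qed
    let ?a = "row_sym X \<rho> :: fsym \<Rightarrow>\<^sub>0 'k"
    have "?a - f * ?a \<in> W"
    proof (rule killed_in_subideal[OF X less.prems W T])
      show "keys (?a - f * ?a) \<subseteq> Sym X"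
        by (intro keys_diff_subset keys_Sym_mult keys_row_sym X kf)
      show "(?a - f * ?a) * single r 1 = ?a - f * ?a" if "r \<in> colour_group X \<rho>" for r
      proof -
        have "?a * single r 1 = ?a" by (rule row_sym_absorb(2)[OF X(1) that])
        then show ?thesis by (simp add: left_diff_distrib mult.assoc)
      qed
      show "(?a - f * ?a) * row_sym X \<rho>' = 0" if "gapfree X \<rho>'" "lex_larger X \<rho> \<rho>'" for \<rho>'
      proof -
        have "?a * row_sym X \<rho>' \<in> W"
          using W IH[OF that] keys_row_sym[OF X(1)] unfolding subideal_def by blast
        then show ?thesis using f(2) by (simp add: left_diff_distrib mult.assoc)
      qed
    qed
    moreover have "f * ?a \<in> W"
      using W f(1) keys_row_sym[OF X(1)] unfolding subideal_def by blast
    ultimately have "(?a - f * ?a) + f * ?a \<in> W" using W unfolding subideal_def by blast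
    then show ?case by simp
  qed
  \<comment> \<open>An injective colouring has all rows of length one, hence a trivial row
    group.\<close>
  obtain h where h: "bij_betw h X {0..<card X}" using ex_bij_betw_finite_nat[OF X(1)] by blast
  have "gapfree X h"
    using h by (auto simp: gapfree_def bij_betw_def atLeast0LessThan)
  moreover have "colour_group X h = {0}"
  proof -
    have "inj_on (\<lambda>s. (h s, h s)) X" using h by (auto simp: bij_betw_def inj_on_def)
    then have "g = 0" if "g \<in> colour_group X h" for g using colour_group_Int that by blast
    then show ?thesis using subgrp_colour_group[OF X(1), of h] by (auto simp: subgrp_def)
  qed
  ultimately have "symmetrizer (\<lambda>_. 1) {0} \<in> W" using rows[of h] by (simp add: row_sym_def)
  then show ?thesis by (simp add: symmetrizer_def single_one)
qed

section \<open>Two-sided ideals\<close>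

lemma scalar_cancel:
  "c \<noteq> 0 \<Longrightarrow> single 0 (1 / c) * (single 0 c * x) = (x :: fsym \<Rightarrow>\<^sub>0 'k::field)"
  by (simp add: mult_single flip: mult.assoc)

definition two_sided :: "'a::ring_1 set \<Rightarrow> bool" where
  "two_sided I \<longleftrightarrow> 0 \<in> I \<and> (\<forall>x\<in>I. \<forall>y\<in>I. x + y \<in> I) \<and> (\<forall>x\<in>I. \<forall>z. z * x \<in> I \<and> x * z \<in> I)"

text \<open>With \<open>L\<close> the part of \<open>I\<close> supported in \<open>Sym X\<close>,
  the right ideal \<open>c L\<close> has a left identity \<open>c l\<close>. Here
  \<open>c l c\<close> is a multiple of \<open>c\<close> that lies in \<open>I\<close>, so it
  vanishes because \<open>c\<close> is outside \<open>I\<close>. Hence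
  \<open>c x = c l c x = 0\<close>.\<close>

lemma young_sym_annihilates:
  fixes I :: "(fsym \<Rightarrow>\<^sub>0 'k::field_char_0) set"
  assumes X: "finite X" "X \<subseteq> {1..}" and T: "tableau X \<rho> \<kappa>" and I: "two_sided I"
    and c: "young_sym X \<rho> \<kappa> \<notin> I" and x: "x \<in> I" "keys x \<subseteq> Sym X"
  shows "young_sym X \<rho> \<kappa> * x = 0"
proof -
  let ?c = "young_sym X \<rho> \<kappa> :: fsym \<Rightarrow>\<^sub>0 'k"
  let ?L = "{x \<in> I. keys x \<subseteq> Sym X}"
  have kc: "keys ?c \<subseteq> Sym X" by (rule keys_young_sym[OF X(1)])
  have "\<exists>f\<in>(\<lambda>u. ?c * u) ` ?L. \<forall>x\<in>(\<lambda>u. ?c * u) ` ?L. f * x = x"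
  proof (rule maschke[OF subgrp_Sym[OF X(1)]])
    show "keys z \<subseteq> Sym X" if "z \<in> (\<lambda>u. ?c * u) ` ?L" for z
      using that keys_Sym_mult[OF X(1) kc] by blast
    have "0 \<in> ?L" using I by (simp add: two_sided_def)
    then show "0 \<in> (\<lambda>u. ?c * u) ` ?L" by (intro image_eqI[of _ _ 0]) simp_all
    show "y + z \<in> (\<lambda>u. ?c * u) ` ?L" if yz: "y \<in> (\<lambda>u. ?c * u) ` ?L" "z \<in> (\<lambda>u. ?c * u) ` ?L" for y z
    proof -
      obtain u v where uv: "y = ?c * u" "u \<in> ?L" "z = ?c * v" "v \<in> ?L" using yz by blast
      then have "u + v \<in> ?L"
        using I keys_add[of u v] unfolding two_sided_def by blast
      then show ?thesis using uv by (intro image_eqI[of _ _ "u + v"]) (simp_all add: distrib_left)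
    qed
    show "y * single g k \<in> (\<lambda>u. ?c * u) ` ?L" if y: "y \<in> (\<lambda>u. ?c * u) ` ?L" and g: "g \<in> Sym X" for y g k
    proof -
      obtain u where u: "y = ?c * u" "u \<in> ?L" using y by blast
      have "keys (single g k) \<subseteq> Sym X" using g by simp
      then have "u * single g k \<in> ?L"
        using I u(2) keys_Sym_mult[OF X(1)] unfolding two_sided_def by blast
      then show ?thesis using u by (intro image_eqI[of _ _ "u * single g k"]) (simp_all add: mult.assoc)
    qed
  qed
  then obtain l where l: "l \<in> ?L" and id: "\<And>x. x \<in> ?L \<Longrightarrow> (?c * l) * (?c * x) = ?c * x"
    by blast
  have "keys (row_sym X \<rho> * l * col_sym X \<kappa>) \<subseteq> Sym X"
    using l by (intro keys_Sym_mult keys_row_sym keys_col_sym X) auto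
  \<comment> \<open>Regrouped so that the outer factors are one column antisymmetrizer and one row
    symmetrizer, as in \<open>col_mult_row_sym\<close>.\<close>
  have "?c * l * ?c = col_sym X \<kappa> * (row_sym X \<rho> * l * col_sym X \<kappa>) * row_sym X \<rho>"
    by (simp add: young_sym_def mult.assoc)
  then obtain k where k: "?c * l * ?c = single 0 k * ?c"
    using col_mult_row_sym[OF X T \<open>keys (row_sym X \<rho> * l * col_sym X \<kappa>) \<subseteq> Sym X\<close>] by auto
  have "k = 0"
  proof (rule ccontr)
    assume "k \<noteq> 0"
    have "?c * l * ?c \<in> I" using I l unfolding two_sided_def by blast
    then have "single 0 (1 / k) * (single 0 k * ?c) \<in> I"
      using I unfolding k two_sided_def by blast
    moreover have "single 0 (1 / k) * (single 0 k * ?c) = ?c"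
      using \<open>k \<noteq> 0\<close> by (rule scalar_cancel)
    ultimately show False using c by simp
  qed
  then have "?c * l * ?c = 0" using k by simp
  then have "(?c * l) * (?c * x) = 0" by (simp flip: mult.assoc)
  then show ?thesis using id[of x] x by simp
qed

lemma finite_support_set:
  fixes x :: "fsym \<Rightarrow>\<^sub>0 'k::zero"
  obtains X where "finite X" "X \<subseteq> {1..}" "keys x \<subseteq> Sym X"
proof
  let ?X = "\<Union>g\<in>keys x. {s. app g s \<noteq> s}"
  show "finite ?X" using app by (auto simp: finitary_sym_group_def)
  show "?X \<subseteq> {1..}"
    using app_permutes permutes_not_in by fastforce
  show "keys x \<subseteq> Sym ?X" by (auto simp: Sym_def)
qed

lemma two_sided_subset:
  fixes I J :: "(fsym \<Rightarrow>\<^sub>0 'k::field_char_0) set"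
  assumes I: "two_sided I" and J: "two_sided J"
    and IJ: "\<And>X \<rho> \<kappa>. finite X \<Longrightarrow> X \<subseteq> {1..} \<Longrightarrow> tableau X \<rho> \<kappa> \<Longrightarrow>
      young_sym X \<rho> \<kappa> \<in> I \<Longrightarrow> young_sym X \<rho> \<kappa> \<in> J"
  shows "I \<subseteq> J"
proof
  fix x assume x: "x \<in> I"
  obtain X where X: "finite X" "X \<subseteq> {1..}" "keys x \<subseteq> Sym X" by (rule finite_support_set)
  \<comment> \<open>The elements carrying the finite part of \<open>I\<close> into \<open>J\<close>
    form an ideal. It contains each Young symmetrizer: one in \<open>I\<close> also lies in
    \<open>J\<close>, and any other annihilates the finite part of \<open>I\<close>. So it contains
    1.\<close>
  define W where "W = {z. keys z \<subseteq> Sym X \<and> (\<forall>x\<in>I. keys x \<subseteq> Sym X \<longrightarrow> z * x \<in> J)}"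
  have "1 \<in> W"
  proof (rule one_in_subideal[OF X(1,2)])
    show "subideal X W"
      unfolding subideal_def
    proof (intro conjI ballI allI impI)
      show "0 \<in> W" using J by (simp add: W_def two_sided_def)
    next
      fix y z assume "y \<in> W" "z \<in> W"
      then show "y + z \<in> W"
        using J keys_add[of y z] unfolding W_def two_sided_def mem_Collect_eq distrib_right by blast
    next
      fix y assume "y \<in> W" then show "keys y \<subseteq> Sym X" by (simp add: W_def)
    next
      fix y z :: "fsym \<Rightarrow>\<^sub>0 'k" assume yz: "y \<in> W" "keys z \<subseteq> Sym X"
      have "z * y * x \<in> J" if "x \<in> I" "keys x \<subseteq> Sym X" for x
        using yz that J unfolding W_def two_sided_def mult.assoc by blast
      moreover have "keys y \<subseteq> Sym X" using yz(1) by (simp add: W_def)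
      then have k: "keys (z * y) \<subseteq> Sym X" "keys (y * z) \<subseteq> Sym X"
        using keys_Sym_mult[OF X(1)] yz(2) by blast+
      ultimately show "z * y \<in> W" by (simp add: W_def)
      have "y * z * x \<in> J" if "x \<in> I" "keys x \<subseteq> Sym X" for x
      proof -
        have "z * x \<in> I" using I that(1) unfolding two_sided_def by blast
        then show ?thesis
          using yz that(2) keys_Sym_mult[OF X(1)] unfolding W_def mult.assoc by blast
      qed
      then show "y * z \<in> W" using k by (simp add: W_def)
    qed
    fix \<rho> \<kappa> assume T: "tableau X \<rho> \<kappa>"
    have "young_sym X \<rho> \<kappa> * x \<in> J" if "x \<in> I" "keys x \<subseteq> Sym X" for x
    proof (cases "young_sym X \<rho> \<kappa> \<in> I")
      case True
      then show ?thesis using IJ[OF X(1,2) T] J unfolding two_sided_def by blast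
    next
      case False
      then show ?thesis
        using young_sym_annihilates[OF X(1,2) T I False that] J by (simp add: two_sided_def)
    qed
    then show "young_sym X \<rho> \<kappa> \<in> W" using keys_young_sym[OF X(1)] by (simp add: W_def)
  qed
  then have "1 * x \<in> J" using x X(3) unfolding W_def by blast
  then show "x \<in> J" by simp
qed

section \<open>Transport between tableaux of the same shape\<close>

lemma bij_betw_extends:
  assumes X: "finite X" "X \<subseteq> {1..}" and Y: "finite Y" "Y \<subseteq> {1..}" and q: "bij_betw q X Y"
  obtains \<sigma> where "\<And>s. s \<in> X \<Longrightarrow> app \<sigma> s = q s"
proof -
  have "card X = card Y" using q by (rule bij_betw_same_card)
  \<comment> \<open>Sending \<open>Y - X\<close> back to \<open>X - Y\<close> closes
    \<open>q\<close> up to a permutation of the union.\<close>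
  then have "card (Y - X) = card (X - Y)"
    using X(1) Y(1) by (metis card_Diff_subset_Int Int_commute finite_Int)
  then obtain h where h: "bij_betw h (Y - X) (X - Y)"
    using finite_same_card_bij[of "Y - X" "X - Y"] X(1) Y(1) by auto
  define p where "p s = (if s \<in> X then q s else if s \<in> Y then h s else s)" for s
  have "bij_betw p X Y" using q by (rule bij_betw_cong[THEN iffD1, rotated]) (simp add: p_def)
  moreover have "bij_betw p (Y - X) (X - Y)"
    using h by (rule bij_betw_cong[THEN iffD1, rotated]) (simp add: p_def)
  ultimately have "bij_betw p (X \<union> (Y - X)) (Y \<union> (X - Y))"
    by (rule bij_betw_combine) auto
  then have "bij_betw p (X \<union> Y) (X \<union> Y)" by (simp add: Un_commute)
  then have "p permutes X \<union> Y" by (rule bij_imp_permutes) (simp add: p_def)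
  moreover have "finite (X \<union> Y)" "X \<union> Y \<subseteq> {1..}" using X Y by auto
  ultimately obtain \<sigma> where "app \<sigma> = p" by (rule fsym_of_permutes)
  then show thesis using that[of \<sigma>] by (simp add: p_def)
qed

lemma colour_group_cong:
  assumes "\<And>s. s \<in> X \<Longrightarrow> \<rho> s = \<rho>' s"
  shows "colour_group X \<rho> = colour_group X \<rho>'"
  using assms Sym_app_in by (auto simp: colour_group_def)

lemma young_sym_conj:
  fixes I :: "(fsym \<Rightarrow>\<^sub>0 'k::field_char_0) set"
  assumes I: "two_sided I" and c: "young_sym X \<rho> \<kappa> \<in> I"
    and \<rho>': "\<And>s. s \<in> X \<Longrightarrow> \<rho>' (app \<sigma> s) = \<rho> s" and \<kappa>': "\<And>s. s \<in> X \<Longrightarrow> \<kappa>' (app \<sigma> s) = \<kappa> s"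
  shows "young_sym (app \<sigma> ` X) \<rho>' \<kappa>' \<in> I"
proof -
  have cg: "colour_group (app \<sigma> ` X) (\<lambda>s. \<rho> (app (- \<sigma>) s)) = colour_group (app \<sigma> ` X) \<rho>'"
    by (rule colour_group_cong) (auto simp: \<rho>')
  have cg': "colour_group (app \<sigma> ` X) (\<lambda>s. \<kappa> (app (- \<sigma>) s)) = colour_group (app \<sigma> ` X) \<kappa>'"
    by (rule colour_group_cong) (auto simp: \<kappa>')
  have "single \<sigma> 1 * young_sym X \<rho> \<kappa> = (young_sym (app \<sigma> ` X) \<rho>' \<kappa>' * single \<sigma> 1 :: fsym \<Rightarrow>\<^sub>0 'k)"
  proof -
    have "single \<sigma> 1 * col_sym X \<kappa> = (col_sym (app \<sigma> ` X) \<kappa>' * single \<sigma> 1 :: fsym \<Rightarrow>\<^sub>0 'k)"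
      using col_sym_conj[of \<sigma> X \<kappa>] by (simp add: col_sym_def cg')
    moreover have "single \<sigma> 1 * row_sym X \<rho> = (row_sym (app \<sigma> ` X) \<rho>' * single \<sigma> 1 :: fsym \<Rightarrow>\<^sub>0 'k)"
      using row_sym_conj[of \<sigma> X \<rho>] by (simp add: row_sym_def cg)
    ultimately show ?thesis unfolding young_sym_def by (metis mult.assoc)
  qed
  then have "single \<sigma> 1 * young_sym X \<rho> \<kappa> * single (- \<sigma>) 1 =
      (young_sym (app \<sigma> ` X) \<rho>' \<kappa>' * single \<sigma> 1 * single (- \<sigma>) 1 :: fsym \<Rightarrow>\<^sub>0 'k)"
    by simp
  also have "\<dots> = young_sym (app \<sigma> ` X) \<rho>' \<kappa>'"
    by (simp add: mult.assoc mult_single)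
  finally have "single \<sigma> 1 * young_sym X \<rho> \<kappa> * single (- \<sigma>) 1 =
      (young_sym (app \<sigma> ` X) \<rho>' \<kappa>' :: fsym \<Rightarrow>\<^sub>0 'k)" .
  moreover have "single \<sigma> 1 * young_sym X \<rho> \<kappa> * single (- \<sigma>) 1 \<in> I"
    using I c unfolding two_sided_def by blast
  ultimately show ?thesis by simp
qed

text \<open>\<open>Suc\<close> makes the code of a cell a positive integer, so cells themselves can
  serve as the points being permuted.\<close>

definition cell :: "nat \<times> nat \<Rightarrow> nat" where
  "cell p = Suc (prod_encode p)"

definition cell_row :: "nat \<Rightarrow> nat" where
  "cell_row s = fst (prod_decode (s - 1))"

definition cell_col :: "nat \<Rightarrow> nat" where
  "cell_col s = snd (prod_decode (s - 1))"

text \<open>A canonical representative for each shape, chosen so that nested diagrams occupy nested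
  sets of points.\<close>

definition diagram_sym :: "(nat \<times> nat) set \<Rightarrow> fsym \<Rightarrow>\<^sub>0 'k::field_char_0" where
  "diagram_sym D = young_sym (cell ` D) cell_row cell_col"

lemma cell_row_cell [simp]: "cell_row (cell p) = fst p" and cell_col_cell [simp]: "cell_col (cell p) = snd p"
  by (simp_all add: cell_row_def cell_col_def cell_def)

lemma cell_set: "finite D \<Longrightarrow> finite (cell ` D)" "cell ` D \<subseteq> {1..}" "inj_on cell D"
  by (auto simp: cell_def inj_on_def)

text \<open>Tableaux of the same shape are conjugate under a finitary permutation, and two-sided
  ideals are stable under conjugation.\<close>

lemma young_sym_iff_diagram_sym:
  fixes I :: "(fsym \<Rightarrow>\<^sub>0 'k::field_char_0) set"
  assumes X: "finite X" "X \<subseteq> {1..}" and T: "tableau X \<rho> \<kappa>" and I: "two_sided I"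
  shows "young_sym X \<rho> \<kappa> \<in> I \<longleftrightarrow> diagram_sym ((\<lambda>s. (\<rho> s, \<kappa> s)) ` X) \<in> I"
proof -
  let ?D = "(\<lambda>s. (\<rho> s, \<kappa> s)) ` X"
  have "inj_on (\<lambda>s. cell (\<rho> s, \<kappa> s)) X"
    using T by (simp add: tableau_def cell_def inj_on_def)
  then have "bij_betw (\<lambda>s. cell (\<rho> s, \<kappa> s)) X (cell ` ?D)"
    by (simp add: bij_betw_def image_image)
  then obtain \<sigma> where \<sigma>: "\<And>s. s \<in> X \<Longrightarrow> app \<sigma> s = cell (\<rho> s, \<kappa> s)"
    using bij_betw_extends[OF X cell_set(1)[OF finite_imageI[OF X(1)]] cell_set(2)] by blast
  then have img: "app \<sigma> ` X = cell ` ?D" by (simp add: image_image)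
  then have img': "app (- \<sigma>) ` (cell ` ?D) = X" 
  proof -
    have "app (- \<sigma>) ` (cell ` ?D) = app (- \<sigma>) ` (app \<sigma> ` X)" by (simp only: img)
    then show ?thesis by (simp add: image_image)
  qed
  show ?thesis
  proof
    assume "young_sym X \<rho> \<kappa> \<in> I"
    then have "young_sym (app \<sigma> ` X) cell_row cell_col \<in> I"
      by (rule young_sym_conj[OF I]) (simp_all add: \<sigma>)
    then show "diagram_sym ?D \<in> I" by (simp only: diagram_sym_def img)
  next
    assume "diagram_sym ?D \<in> I"
    then have c: "young_sym (cell ` ?D) cell_row cell_col \<in> I" by (simp only: diagram_sym_def)
    have "app (- \<sigma>) (cell (\<rho> s, \<kappa> s)) = s" if "s \<in> X" for s
      by (simp flip: \<sigma>[OF that])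
    then have "young_sym (app (- \<sigma>) ` (cell ` ?D)) \<rho> \<kappa> \<in> I"
      by (intro young_sym_conj[OF I c]) auto
    then show "young_sym X \<rho> \<kappa> \<in> I" by (simp only: img')
  qed
qed

text \<open>The row and column groups for \<open>D\<close> are contained in those for
  \<open>E\<close>. The larger symmetrizers absorb the smaller ones up to the group orders, which
  are invertible in characteristic 0.\<close>

lemma diagram_sym_mono:
  fixes I :: "(fsym \<Rightarrow>\<^sub>0 'k::field_char_0) set"
  assumes E: "finite E" "D \<subseteq> E" and I: "two_sided I" and D: "diagram_sym D \<in> I"
  shows "diagram_sym E \<in> I"
proof -
  let ?X = "cell ` D" and ?Y = "cell ` E"
  have XY: "?X \<subseteq> ?Y" "finite ?Y" "finite ?X" using E finite_subset by auto
  have sub: "colour_group ?X \<rho> \<subseteq> colour_group ?Y \<rho>" for \<rho>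
  proof
    fix g assume g: "g \<in> colour_group ?X \<rho>"
    then have fixed: "app g s = s" if "s \<notin> ?X" for s
      using that unfolding colour_group_def Sym_def by blast
    have "\<rho> (app g s) = \<rho> s" for s
    proof (cases "s \<in> ?X")
      case True
      then show ?thesis using g unfolding colour_group_def by blast
    qed (simp add: fixed)
    moreover have "g \<in> Sym ?Y" unfolding Sym_def using fixed XY(1) by blast
    ultimately show "g \<in> colour_group ?Y \<rho>" by (simp add: colour_group_def)
  qed
  have pos: "(of_nat (card (colour_group ?X \<rho>)) :: 'k) \<noteq> 0" for \<rho>
    using subgrp_colour_group[OF XY(3), of \<rho>] by (auto simp: subgrp_def)
  let ?m = "of_nat (card (colour_group ?X cell_row)) :: 'k" and ?n = "of_nat (card (colour_group ?X cell_col)) :: 'k"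
  have r: "row_sym ?X cell_row * row_sym ?Y cell_row = single 0 ?m * (row_sym ?Y cell_row :: fsym \<Rightarrow>\<^sub>0 'k)"
    unfolding row_sym_def
    by (subst symmetrizer_mult_subset(1)[OF subgrp_colour_group[OF XY(2)] sub]) simp_all
  have c: "col_sym ?Y cell_col * col_sym ?X cell_col = single 0 ?n * (col_sym ?Y cell_col :: fsym \<Rightarrow>\<^sub>0 'k)"
    unfolding col_sym_def
    by (subst symmetrizer_mult_subset(2)[OF subgrp_colour_group[OF XY(2)] sub psgn_add]) simp_all
  have "col_sym ?Y cell_col * diagram_sym D * row_sym ?Y cell_row =
      (col_sym ?Y cell_col * col_sym ?X cell_col) * (row_sym ?X cell_row * row_sym ?Y cell_row :: fsym \<Rightarrow>\<^sub>0 'k)"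
    by (simp add: diagram_sym_def young_sym_def mult.assoc)
  also have "\<dots> = single 0 ?n * (col_sym ?Y cell_col * single 0 ?m) * row_sym ?Y cell_row"
    unfolding r c by (simp only: mult.assoc)
  also have "\<dots> = single 0 (?n * ?m) * diagram_sym E"
    unfolding scalar_commute[of ?m, symmetric]
    unfolding diagram_sym_def young_sym_def
    by (simp only: mult.assoc[symmetric] mult_single add_0)
  finally have eq: "col_sym ?Y cell_col * diagram_sym D * row_sym ?Y cell_row =
      single 0 (?n * ?m) * (diagram_sym E :: fsym \<Rightarrow>\<^sub>0 'k)" .
  have "single 0 (?n * ?m) * diagram_sym E \<in> I"
    unfolding eq[symmetric] using I D unfolding two_sided_def by blast
  then have "single 0 (1 / (?n * ?m)) * (single 0 (?n * ?m) * diagram_sym E) \<in> I"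
    using I unfolding two_sided_def by blast
  moreover have "single 0 (1 / (?n * ?m)) * (single 0 (?n * ?m) * (diagram_sym E :: fsym \<Rightarrow>\<^sub>0 'k)) = diagram_sym E"
    using pos[of cell_row] pos[of cell_col] by (intro scalar_cancel) (simp only: mult_eq_0_iff simp_thms)
  ultimately show ?thesis by simp
qed

text \<open>The diagrams recorded in \<open>E\<close> are those outside the ideal, hence the
  reversed inclusion.\<close>

lemma two_sided_comparable:
  fixes I :: "nat \<Rightarrow> (fsym \<Rightarrow>\<^sub>0 'k::field_char_0) set"
  assumes I: "\<And>i. two_sided (I i)"
  shows "\<exists>i j. i < j \<and> I j \<subseteq> I i"
proof -
  define E where "E i = {D. finite D \<and> young D \<and> diagram_sym D \<notin> I i}" for i
  have "E i \<in> {E. downset (\<subseteq>) {D. finite D \<and> young D} E}" for i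
    using diagram_sym_mono[OF _ _ I] by (auto simp: E_def downset_def)
  then obtain i j where ij: "i < j" "E i \<subseteq> E j"
    using wqo_onD[OF wqo_on_young_downsets, of E] by metis
  have "I j \<subseteq> I i"
  proof (rule two_sided_subset[OF I I])
    fix X \<rho> \<kappa> assume X: "finite X" "X \<subseteq> {1..}" and T: "tableau X \<rho> \<kappa>" and "young_sym X \<rho> \<kappa> \<in> I j"
    then have "diagram_sym ((\<lambda>s. (\<rho> s, \<kappa> s)) ` X) \<in> I j"
      using young_sym_iff_diagram_sym[OF X T I] by blast
    moreover have "finite ((\<lambda>s. (\<rho> s, \<kappa> s)) ` X)" "young ((\<lambda>s. (\<rho> s, \<kappa> s)) ` X)"
      using X T by (simp_all add: tableau_def)
    ultimately have "diagram_sym ((\<lambda>s. (\<rho> s, \<kappa> s)) ` X) \<in> I i"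
      using ij(2) unfolding E_def by blast
    then show "young_sym X \<rho> \<kappa> \<in> I i"
      using young_sym_iff_diagram_sym[OF X T I] by blast
  qed
  then show ?thesis using ij(1) by blast
qed

section \<open>Coefficient functions\<close>

text \<open>\<open>Fsym\<close> is unspecified off the carrier, hence the explicit 0. The map
  respects sums and products and is onto, which suffices to pull ideals back and compare
  them.\<close>

definition coefficients :: "(fsym \<Rightarrow>\<^sub>0 'k::field_char_0) \<Rightarrow> (nat \<Rightarrow> nat) \<Rightarrow> 'k" where
  "coefficients x p = (if p \<in> range app then lookup x (Fsym p) else 0)"

lemma range_app: "range app = carrier (finitary_sym_group {1..})"
  by (rule type_definition.Rep_range[OF type_definition_fsym])

lemma coefficients_app [simp]: "coefficients x (app g) = lookup x g"
  by (simp add: coefficients_def app_inverse)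

lemma coefficients_support: "{p. coefficients x p \<noteq> 0} = app ` keys x"
proof (intro equalityI subsetI)
  fix p assume "p \<in> {p. coefficients x p \<noteq> 0}"
  then have nz: "coefficients x p \<noteq> 0" by simp
  then have "p \<in> range app" by (simp add: coefficients_def split: if_splits)
  then obtain g where "p = app g" by blast
  then show "p \<in> app ` keys x" using nz by (simp add: in_keys_iff)
qed (auto simp: in_keys_iff)

lemma coefficients_eqI:
  assumes "\<And>p. p \<notin> range app \<Longrightarrow> f p = 0" "\<And>g. lookup x g = f (app g)"
  shows "coefficients x = f"
proof
  fix p show "coefficients x p = f p"
    using assms by (cases "p \<in> range app") (auto simp: coefficients_def app_inverse)
qed

lemma coefficients_carrier: "coefficients x \<in> carrier (group_algebra (finitary_sym_group {1..}))"
  unfolding group_algebra_def using app by (auto simp: coefficients_support)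

lemma coefficients_surj:
  assumes f: "f \<in> carrier (group_algebra (finitary_sym_group {1..}))"
  obtains x where "coefficients x = f"
proof -
  have fin: "finite {p. f p \<noteq> 0}" and sub: "{p. f p \<noteq> 0} \<subseteq> range app"
    using f unfolding range_app by (simp_all add: group_algebra_def)
  define x where "x = (\<Sum>p | f p \<noteq> 0. single (Fsym p) (f p))"
  have "coefficients x = f"
  proof (rule coefficients_eqI)
    show "f p = 0" if "p \<notin> range app" for p using sub that by blast
    fix g
    have "lookup x g = (\<Sum>p | f p \<noteq> 0. if p = app g then f p else 0)"
      unfolding x_def lookup_sum
    proof (intro sum.cong refl)
      fix p assume "p \<in> {p. f p \<noteq> 0}"
      then obtain h where "p = app h" using sub by blast
      then show "lookup (single (Fsym p) (f p)) g = (if p = app g then f p else 0)"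
        by (simp add: app_inverse app_inject lookup_single when_def)
    qed
    also have "\<dots> = f (app g)" using fin by simp
    finally show "lookup x g = f (app g)" .
  qed
  then show thesis using that by blast
qed

lemma coefficients_add:
  "coefficients (x + y) = coefficients x \<oplus>\<^bsub>group_algebra (finitary_sym_group {1..})\<^esub> coefficients y"
  by (rule coefficients_eqI) (auto simp: group_algebra_def lookup_add coefficients_def app_inverse)

lemma coefficients_mult:
  "coefficients (x * y) = coefficients x \<otimes>\<^bsub>group_algebra (finitary_sym_group {1..})\<^esub> coefficients y"
proof -
  let ?G = "finitary_sym_group ({1..} :: nat set)"
  have inj: "inj_on app A" for A by (auto intro: inj_onI simp: app_inject)
  have mult: "app a \<otimes>\<^bsub>?G\<^esub> app b = app (a + b)" for a b
    by (simp add: finitary_sym_group_def fun_eq_iff)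
  have eq: "(coefficients x \<otimes>\<^bsub>group_algebra ?G\<^esub> coefficients y) p =
      (\<Sum>a\<in>keys x. \<Sum>b\<in>keys y. if app (a + b) = p then lookup x a * lookup y b else 0)" for p
    by (subst group_algebra_mult_eq[of "app ` keys x" _ "app ` keys y"])
      (simp_all add: coefficients_support sum.reindex[OF inj] mult del: One_nat_def cong: if_cong)
  show ?thesis
  proof (rule coefficients_eqI)
    show "(coefficients x \<otimes>\<^bsub>group_algebra ?G\<^esub> coefficients y) p = 0" if "p \<notin> range app" for p
      unfolding eq using that by (intro sum.neutral ballI) auto
    fix g
    have "x * y = (\<Sum>a\<in>keys x. single a (lookup x a)) * (\<Sum>b\<in>keys y. single b (lookup y b))"
      by (simp flip: poly_mapping_sum_single)
    also have "\<dots> = (\<Sum>a\<in>keys x. \<Sum>b\<in>keys y. single (a + b) (lookup x a * lookup y b))"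
      by (simp add: sum_product mult_single)
    finally show "lookup (x * y) g = (coefficients x \<otimes>\<^bsub>group_algebra ?G\<^esub> coefficients y) (app g)"
      unfolding eq by (simp add: lookup_sum lookup_single when_def app_inject)
  qed
qed

lemma two_sided_coefficients:
  fixes I :: "((nat \<Rightarrow> nat) \<Rightarrow> 'k::field_char_0) set"
  assumes "ideal I (group_algebra (finitary_sym_group {1..}))"
  shows "two_sided {x. coefficients x \<in> I}"
proof -
  interpret ideal I "group_algebra (finitary_sym_group {1..}) :: ((nat \<Rightarrow> nat) \<Rightarrow> 'k) ring" by fact
  have "coefficients (0 :: fsym \<Rightarrow>\<^sub>0 'k) = \<zero>\<^bsub>group_algebra (finitary_sym_group {1..})\<^esub>"
    by (rule coefficients_eqI) (auto simp: group_algebra_def)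
  then have "coefficients (0 :: fsym \<Rightarrow>\<^sub>0 'k) \<in> I" 
    using additive_subgroup.zero_closed[OF ideal.axioms(1)[OF assms]] by (simp only:)
  then show ?thesis
    unfolding two_sided_def
    by (auto simp: coefficients_add coefficients_mult a_closed I_l_closed I_r_closed coefficients_carrier
        simp del: One_nat_def)
qed

theorem theorem6p1:
  assumes "countable (UNIV :: 'k::field_char_0 set)"
  shows "\<not> (\<exists>I :: nat \<Rightarrow> ((nat \<Rightarrow> nat) \<Rightarrow> 'k) set.
           (\<forall>i. ideal (I i) (group_algebra (finitary_sym_group {1..}))) \<and>
           (\<forall>i j. i \<noteq> j \<longrightarrow> \<not> I i \<subseteq> I j))"
proof
  assume "\<exists>I :: nat \<Rightarrow> ((nat \<Rightarrow> nat) \<Rightarrow> 'k) set.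
           (\<forall>i. ideal (I i) (group_algebra (finitary_sym_group {1..}))) \<and>
           (\<forall>i j. i \<noteq> j \<longrightarrow> \<not> I i \<subseteq> I j)"
  then obtain I :: "nat \<Rightarrow> ((nat \<Rightarrow> nat) \<Rightarrow> 'k) set" where
    I: "\<And>i. ideal (I i) (group_algebra (finitary_sym_group {1..}))"
    and incomparable: "\<And>i j. i \<noteq> j \<Longrightarrow> \<not> I i \<subseteq> I j"
    by blast
  obtain i j where ij: "i < j" "{x. coefficients x \<in> I j} \<subseteq> {x. coefficients x \<in> I i}"
    using two_sided_comparable[of "\<lambda>i. {x. coefficients x \<in> I i}"] two_sided_coefficients[OF I] by blast
  have "I j \<subseteq> I i"
  proof
    fix f assume f: "f \<in> I j"
    then have "f \<in> carrier (group_algebra (finitary_sym_group {1..}))"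
      using ideal.Icarr[OF I] by blast
    then obtain x where "coefficients x = f" by (rule coefficients_surj)
    then show "f \<in> I i" using f ij(2) by blast
  qed
  then show False using incomparable[of j i] ij(1) by simp
qed

end
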